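(* Let $\mathfrak{M}$ be a matchbox manifold with holonomy pseudogroup $\mathcal{G}_{\mathfrak{X}}$, acting on the transversal space $\mathfrak{X}$, for some regular foliated covering of $\mathfrak{M}$. Suppose there exists a metric $d_{\mathfrak{X}}$ on $\mathfrak{X}$, defining its topology, for which the geometric entropy satisfies $h(\mathcal{G}_{\mathfrak{X}},d_{\mathfrak{X}})=\infty$. Then $\mathfrak{M}$ is not homeomorphic to an invariant set for any $C^1$-foliation.
   Context: **Matchbox manifolds.** A foliated space of dimension $n$ is a compact metrizable space $\mathfrak{M}$ for which there is a separable metric space $\mathfrak{X}$ such that each $x\in\mathfrak{M}$ has an open neighborhood $U_x$, a compact set $\mathfrak{X}_x\subset\mathfrak{X}$ and a homeomorphism $\varphi_x\colon \overline{U}_x\to[-1,1]^n\times\mathfrak{X}_x$ with $\varphi_x(x)=(0,w_x)$, $w_x\in \mathrm{int}(\mathfrak{X}_x)$, which extends to a foliated homeomorphism $\widehat U_x\to(-2,2)^n\times\mathfrak{X}_x$ on some $\widehat U_x\supset\overline U_x$. Plaques are the sets $\varphi_x^{-1}([-1,1]^n\times\{w\})$. The sets $\varphi_x^{-1}(V\times\{w\})$, $V\subset(-1,1)^n$ open, form a basis of the fine topology, whose connected components are the leaves; they form the foliation $\mathcal{F}$ of $\mathfrak{M}$. The foliated space is smooth if the charts can be chosen so that the transition maps between plaques are smooth and depend continuously on the transverse parameter in the $C^\infty$-topology. A matchbox manifold is a connected smooth foliated space for which $\mathfrak{X}$ is totally disconnected and each $\mathfrak{X}_x$ is clopen in $\mathfrak{X}$.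 It is equipped with a leafwise Riemannian metric varying continuously. **Holonomy pseudogroup.** A regular foliated covering is a finite covering by charts $\varphi_i\colon\overline U_i\to[-1,1]^n\times\mathfrak{X}_i$, $1\le i\le\nu$, of small diameter, whose plaques are strongly convex in the leafwise metric and of uniformly small leafwise size (for some $\delta<\lambda/5$, where all leafwise balls of radius $\lambda$ are strongly convex, each plaque contains the leafwise $\delta/2$-ball, and is contained in the leafwise $\delta$-ball, about its center), and for which each $\mathfrak{X}_{i,j}=\pi_i(U_i\cap U_j)\subset\mathfrak{X}_i$ is clopen, where $\pi_i\colon \overline U_i\to\mathfrak{X}_i$ is the projection. Put $\mathfrak{X}=\mathfrak{X}_1\sqcup\cdots\sqcup\mathfrak{X}_\nu$. When $U_i\cap U_j\neq\emptyset$, intersection of plaques defines a homeomorphism $h_{i,j}\colon\mathfrak{X}_{i,j}\to\mathfrak{X}_{j,i}$. The holonomy pseudogroup $\mathcal{G}_{\mathfrak{X}}$ is the pseudogroup on $\mathfrak{X}$ generated by these maps. Let $\mathcal{G}_{\mathfrak{X}}^*$ be the set of all compositions of the generators, on the maximal domains on which the composition is defined, and let the word length $\|g\|$ of $g\in\mathcal{G}_{\mathfrak{X}}^*$ be the least number of generators in such a composition. **Geometric entropy.** For $\epsilon,\ell>0$, a subset $\mathcal{E}\subset\mathfrak{X}$ is $(d_{\mathfrak{X}},\epsilon,\ell)$-separated if for all distinct $w,w'\in\mathcal{E}$ lying in a common $\mathfrak{X}_i$ there is $g\in\mathcal{G}_{\mathfrak{X}}^*$ with $w,w'\in\mathrm{Dom}(g)\subset\mathfrak{X}_i$,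 word length at most $\ell$, and $d_{\mathfrak{X}}(g(w),g(w'))\ge\epsilon$ (points in different $\mathfrak{X}_i$ are separated by default). Let $h(\mathcal{G}_{\mathfrak{X}},d_{\mathfrak{X}},\epsilon,\ell)$ be the maximal cardinality of such a set, and $$h(\mathcal{G}_{\mathfrak{X}},d_{\mathfrak{X}},\epsilon)=\limsup_{\ell\to\infty}\frac{\ln h(\mathcal{G}_{\mathfrak{X}},d_{\mathfrak{X}},\epsilon,\ell)}{\ell},\qquad h(\mathcal{G}_{\mathfrak{X}},d_{\mathfrak{X}})=\lim_{\epsilon\to0}h(\mathcal{G}_{\mathfrak{X}},d_{\mathfrak{X}},\epsilon)\in[0,\infty].$$ **Invariant sets.** An invariant set of a foliation $\mathcal{F}_M$ of a manifold $M$ is a union of leaves; a compact invariant set is regarded as foliated by the leaves it contains. In the non-embedding statement, $\mathcal{F}_M$ is understood to have the same leaf dimension as $\mathfrak{M}$ and homeomorphisms are understood to carry leaves of $\mathcal{F}$ onto leaves of $\mathcal{F}_M$. *)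

theory Defs
  imports "HOL-Analysis.Analysis"
begin

section \<open>Differentiability on Euclidean spaces\<close>

definition open_cube :: "real \<Rightarrow> (real ^ 'n) set" where
  "open_cube r = {y. \<forall>i. \<bar>y $ i\<bar> < r}"

definition closed_cube :: "real \<Rightarrow> (real ^ 'n) set" where
  "closed_cube r = {y. \<forall>i. \<bar>y $ i\<bar> \<le> r}"

definition C1_on :: "('e::euclidean_space \<Rightarrow> 'f::real_normed_vector) \<Rightarrow> 'e set \<Rightarrow> bool" where
  "C1_on f S \<longleftrightarrow> (\<exists>f' :: 'e \<Rightarrow> 'e \<Rightarrow>\<^sub>L 'f.
     (\<forall>x\<in>S. (f has_derivative blinfun_apply (f' x)) (at x)) \<and> continuous_on S f')"

primrec iter_partial ::
  "'e list \<Rightarrow> ('e::euclidean_space \<Rightarrow> 'f::real_normed_vector) \<Rightarrow> 'e \<Rightarrow> 'f" where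
  "iter_partial [] f = f"
| "iter_partial (b # bs) f = (\<lambda>x. frechet_derivative (iter_partial bs f) (at x) b)"

(* Meant for open S: every iterated partial derivative is (Frechet) differentiable on S. *)
definition C_infinity_on ::
  "('e::euclidean_space \<Rightarrow> 'f::real_normed_vector) \<Rightarrow> 'e set \<Rightarrow> bool" where
  "C_infinity_on f S \<longleftrightarrow>
     (\<forall>bs\<in>lists Basis. \<forall>x\<in>S. iter_partial bs f differentiable (at x))"

(* A family of smooth maps f(-,w) on the open set B, indexed by w in an open subset W of X,
   which depends continuously on w in the C-infinity topology, i.e. the topology of uniform
   convergence of all iterated partial derivatives on compact subsets of B. *)
definition smooth_family ::
  "'x topology \<Rightarrow> 'e set \<Rightarrow> 'x set \<Rightarrow> ('e::euclidean_space \<Rightarrow> 'x \<Rightarrow> 'f::real_normed_vector) \<Rightarrow> bool"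
  where
  "smooth_family X B W f \<longleftrightarrow>
     (\<forall>w\<in>W. C_infinity_on (\<lambda>y. f y w) B) \<and>
     (\<forall>bs\<in>lists Basis. \<forall>K. compact K \<and> K \<subseteq> B \<longrightarrow> (\<forall>w\<in>W. \<forall>e>0.
        \<exists>W'. openin X W' \<and> w \<in> W' \<and> (\<forall>w'\<in>W' \<inter> W. \<forall>y\<in>K.
          norm (iter_partial bs (\<lambda>y. f y w') y - iter_partial bs (\<lambda>y. f y w) y) < e)))"


section \<open>Foliated spaces\<close>

(* A chart phi of a foliated space: chart_dom is the open set U, chart_trans the compact
   transversal, and chart_map is phi; only its values on the closure of U matter. *)
record ('a, 'n, 'x) fol_chart =
  chart_dom :: "'a set"
  chart_trans :: "'x set"
  chart_map :: "'a \<Rightarrow> (real ^ 'n::finite) \<times> 'x"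

definition leaf_coord :: "('a, 'n::finite, 'x) fol_chart \<Rightarrow> 'a \<Rightarrow> real ^ 'n" where
  "leaf_coord c p = fst (chart_map c p)"

definition trans_coord :: "('a, 'n::finite, 'x) fol_chart \<Rightarrow> 'a \<Rightarrow> 'x" where
  "trans_coord c p = snd (chart_map c p)"

definition chart_inv ::
  "'a topology \<Rightarrow> ('a, 'n::finite, 'x) fol_chart \<Rightarrow> (real ^ 'n) \<times> 'x \<Rightarrow> 'a" where
  "chart_inv M c = inv_into (M closure_of chart_dom c) (chart_map c)"

definition plaque :: "'a topology \<Rightarrow> ('a, 'n::finite, 'x) fol_chart \<Rightarrow> 'x \<Rightarrow> 'a set" where
  "plaque M c w = {p \<in> M closure_of chart_dom c. trans_coord c p = w}"

definition fine_topology :: "'a topology \<Rightarrow> ('a, 'n::finite, 'x) fol_chart set \<Rightarrow> 'a topology" where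
  "fine_topology M A = topology_generated_by
     {{p \<in> plaque M c w. leaf_coord c p \<in> V} | c V w.
        c \<in> A \<and> w \<in> chart_trans c \<and> open V \<and> V \<subseteq> open_cube 1}"

definition leaves :: "'a topology \<Rightarrow> ('a, 'n::finite, 'x) fol_chart set \<Rightarrow> 'a set set" where
  "leaves M A = connected_components_of (fine_topology M A)"

(* U is normalised to be the set of points with coordinates in (-1,1)^n times int(T), where T is
   the transversal (for clopen T this is the interior of its closure).  That the extension phi'
   is foliated means that its plaques lie in leaves. *)
definition foliated_chart ::
  "'a topology \<Rightarrow> 'x topology \<Rightarrow> ('a, 'n::finite, 'x) fol_chart set
     \<Rightarrow> ('a, 'n, 'x) fol_chart \<Rightarrow> bool" where
  "foliated_chart M X A c \<longleftrightarrow>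
     (let U = chart_dom c; T = chart_trans c; \<phi> = chart_map c;
          E = prod_topology (euclidean :: (real ^ 'n) topology) X in
      openin M U \<and> U \<noteq> {} \<and> compactin X T \<and>
      homeomorphic_map (subtopology M (M closure_of U)) (subtopology E (closed_cube 1 \<times> T)) \<phi> \<and>
      \<phi> ` U = open_cube 1 \<times> (X interior_of T) \<and>
      (\<exists>U' \<phi>'. M closure_of U \<subseteq> U' \<and> U' \<subseteq> topspace M \<and>
         homeomorphic_map (subtopology M U') (subtopology E (open_cube 2 \<times> T)) \<phi>' \<and>
         (\<forall>p \<in> M closure_of U. \<phi>' p = \<phi> p) \<and>
         (\<forall>w\<in>T. \<exists>L\<in>leaves M A. {p \<in> U'. snd (\<phi>' p) = w} \<subseteq> L)))"

definition foliated_space ::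
  "'a topology \<Rightarrow> 'x topology \<Rightarrow> ('a, 'n::finite, 'x) fol_chart set \<Rightarrow> bool" where
  "foliated_space M X A \<longleftrightarrow>
     compact_space M \<and> metrizable_space M \<and> metrizable_space X \<and> separable_space X \<and>
     (\<forall>c\<in>A. foliated_chart M X A c) \<and>
     (\<forall>x\<in>topspace M. \<exists>c\<in>A. x \<in> chart_dom c \<and> leaf_coord c x = 0)"

(* Near every point of the overlap, the change of coordinates from c to c' maps plaques to
   plaques, smoothly and with continuous dependence on the transverse parameter. *)
definition smooth_transition ::
  "'a topology \<Rightarrow> 'x topology \<Rightarrow> ('a, 'n::finite, 'x) fol_chart
     \<Rightarrow> ('a, 'n, 'x) fol_chart \<Rightarrow> bool" where
  "smooth_transition M X c c' \<longleftrightarrow>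
     (\<forall>z \<in> chart_dom c \<inter> chart_dom c'. \<exists>B W.
        open B \<and> leaf_coord c z \<in> B \<and> B \<subseteq> open_cube 1 \<and>
        openin X W \<and> trans_coord c z \<in> W \<and> W \<subseteq> chart_trans c \<and>
        (\<forall>y\<in>B. \<forall>w\<in>W. chart_inv M c (y, w) \<in> chart_dom c') \<and>
        (\<forall>w\<in>W. \<forall>y\<in>B. \<forall>y'\<in>B.
           trans_coord c' (chart_inv M c (y, w)) = trans_coord c' (chart_inv M c (y', w))) \<and>
        smooth_family X B W (\<lambda>y w. leaf_coord c' (chart_inv M c (y, w))))"

definition smooth_foliated_space ::
  "'a topology \<Rightarrow> 'x topology \<Rightarrow> ('a, 'n::finite, 'x) fol_chart set \<Rightarrow> bool" where
  "smooth_foliated_space M X A \<longleftrightarrow>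
     foliated_space M X A \<and> (\<forall>c\<in>A. \<forall>c'\<in>A. smooth_transition M X c c')"

definition totally_disconnected_space :: "'x topology \<Rightarrow> bool" where
  "totally_disconnected_space X \<longleftrightarrow> (\<forall>S. connectedin X S \<longrightarrow> (\<exists>x. S \<subseteq> {x}))"

definition matchbox_manifold ::
  "'a topology \<Rightarrow> 'x topology \<Rightarrow> ('a, 'n::finite, 'x) fol_chart set \<Rightarrow> bool" where
  "matchbox_manifold M X A \<longleftrightarrow>
     smooth_foliated_space M X A \<and> connected_space M \<and> totally_disconnected_space X \<and>
     (\<forall>c\<in>A. openin X (chart_trans c) \<and> closedin X (chart_trans c))"


section \<open>Leafwise Riemannian geometry\<close>

(* A leafwise metric is given by its Gram matrices G c y w in the charts c of the atlas. *)
type_synonym ('a, 'n, 'x) leaf_metric =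
  "('a, 'n, 'x) fol_chart \<Rightarrow> real ^ 'n \<Rightarrow> 'x \<Rightarrow> real ^ 'n ^ 'n"

definition leaf_inner ::
  "('a, 'n::finite, 'x) leaf_metric \<Rightarrow> ('a, 'n, 'x) fol_chart \<Rightarrow> 'a
     \<Rightarrow> real ^ 'n \<Rightarrow> real ^ 'n \<Rightarrow> real" where
  "leaf_inner G c p u v = u \<bullet> (G c (leaf_coord c p) (trans_coord c p) *v v)"

definition leafwise_riemannian_metric ::
  "'a topology \<Rightarrow> 'x topology \<Rightarrow> ('a, 'n::finite, 'x) fol_chart set
     \<Rightarrow> ('a, 'n, 'x) leaf_metric \<Rightarrow> bool" where
  "leafwise_riemannian_metric M X A G \<longleftrightarrow>
     (\<forall>c\<in>A. smooth_family X (open_cube 1) (X interior_of chart_trans c) (G c) \<and>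
        (\<forall>p\<in>chart_dom c. (\<forall>u v. leaf_inner G c p u v = leaf_inner G c p v u) \<and>
           (\<forall>u. u \<noteq> 0 \<longrightarrow> leaf_inner G c p u u > 0))) \<and>
     (\<forall>c\<in>A. \<forall>c'\<in>A. \<forall>p \<in> chart_dom c \<inter> chart_dom c'.
        let D = frechet_derivative (\<lambda>y. leaf_coord c' (chart_inv M c (y, trans_coord c p)))
                  (at (leaf_coord c p))
        in \<forall>u v. leaf_inner G c p u v = leaf_inner G c' p (D u) (D v))"

(* Piecewise continuously differentiable curves [0,1] -> leaf; S is the set of break points, and
   the derivative has one-sided limits at each of them. *)
definition leafwise_curve ::
  "'a topology \<Rightarrow> ('a, 'n::finite, 'x) fol_chart set \<Rightarrow> (real \<Rightarrow> 'a) \<Rightarrow> bool" where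
  "leafwise_curve M A \<gamma> \<longleftrightarrow>
     continuous_map (top_of_set {0..1}) (fine_topology M A) \<gamma> \<and>
     (\<exists>S. finite S \<and> (\<forall>c\<in>A. \<forall>a b.
        0 \<le> a \<and> a < b \<and> b \<le> 1 \<and> {a<..<b} \<inter> S = {} \<and> \<gamma> ` {a..b} \<subseteq> chart_dom c \<longrightarrow>
        (\<exists>D. continuous_on {a..b} D \<and> (\<forall>t\<in>{a..b}.
           ((\<lambda>s. leaf_coord c (\<gamma> s)) has_vector_derivative D t) (at t within {a..b})))))"

(* The speed does not depend on the choice of the chart c around the point. *)
definition leaf_speed ::
  "('a, 'n::finite, 'x) fol_chart set \<Rightarrow> ('a, 'n, 'x) leaf_metric \<Rightarrow> (real \<Rightarrow> 'a) \<Rightarrow> real \<Rightarrow> real"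
  where
  "leaf_speed A G \<gamma> t =
     (let c = (SOME c. c \<in> A \<and> \<gamma> t \<in> chart_dom c);
          v = vector_derivative (\<lambda>s. leaf_coord c (\<gamma> s)) (at t)
      in sqrt (leaf_inner G c (\<gamma> t) v v))"

definition leaf_length ::
  "('a, 'n::finite, 'x) fol_chart set \<Rightarrow> ('a, 'n, 'x) leaf_metric \<Rightarrow> (real \<Rightarrow> 'a) \<Rightarrow> real" where
  "leaf_length A G \<gamma> = integral {0..1} (leaf_speed A G \<gamma>)"

(* Meaningful for x, y in the same leaf. *)
definition leaf_dist ::
  "'a topology \<Rightarrow> ('a, 'n::finite, 'x) fol_chart set \<Rightarrow> ('a, 'n, 'x) leaf_metric
     \<Rightarrow> 'a \<Rightarrow> 'a \<Rightarrow> real" where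
  "leaf_dist M A G x y =
     Inf {leaf_length A G \<gamma> | \<gamma>. leafwise_curve M A \<gamma> \<and> \<gamma> 0 = x \<and> \<gamma> 1 = y}"

definition leaf_ball ::
  "'a topology \<Rightarrow> ('a, 'n::finite, 'x) fol_chart set \<Rightarrow> ('a, 'n, 'x) leaf_metric
     \<Rightarrow> 'a \<Rightarrow> real \<Rightarrow> 'a set" where
  "leaf_ball M A G x r = {y. (\<exists>L\<in>leaves M A. x \<in> L \<and> y \<in> L) \<and> leaf_dist M A G x y \<le> r}"

(* Shortest geodesic segments: curves which realise the distance between their end points and are
   parametrised proportionally to arc length. *)
definition shortest_geodesic ::
  "'a topology \<Rightarrow> ('a, 'n::finite, 'x) fol_chart set \<Rightarrow> ('a, 'n, 'x) leaf_metric
     \<Rightarrow> 'a \<Rightarrow> 'a \<Rightarrow> (real \<Rightarrow> 'a) \<Rightarrow> bool" where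
  "shortest_geodesic M A G x y \<gamma> \<longleftrightarrow>
     leafwise_curve M A \<gamma> \<and> \<gamma> 0 = x \<and> \<gamma> 1 = y \<and> leaf_length A G \<gamma> = leaf_dist M A G x y \<and>
     (\<forall>t\<in>{0..1}. integral {0..t} (leaf_speed A G \<gamma>) = t * leaf_length A G \<gamma>)"

definition strongly_convex ::
  "'a topology \<Rightarrow> ('a, 'n::finite, 'x) fol_chart set \<Rightarrow> ('a, 'n, 'x) leaf_metric
     \<Rightarrow> 'a set \<Rightarrow> bool" where
  "strongly_convex M A G C \<longleftrightarrow>
     (\<forall>x\<in>C. \<forall>y\<in>C. \<exists>\<gamma>. shortest_geodesic M A G x y \<gamma> \<and> \<gamma> ` {0..1} \<subseteq> C \<and>
        (\<forall>\<gamma>'. shortest_geodesic M A G x y \<gamma>' \<longrightarrow> (\<forall>t\<in>{0..1}. \<gamma>' t = \<gamma> t)))"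


section \<open>Regular foliated coverings and the holonomy pseudogroup\<close>

definition metric_for :: "'b topology \<Rightarrow> ('b \<Rightarrow> 'b \<Rightarrow> real) \<Rightarrow> bool" where
  "metric_for T d \<longleftrightarrow>
     Metric_space (topspace T) d \<and> Metric_space.mtopology (topspace T) d = T"

definition overlap_trans ::
  "(nat \<Rightarrow> ('a, 'n::finite, 'x) fol_chart) \<Rightarrow> nat \<Rightarrow> nat \<Rightarrow> 'x set" where
  "overlap_trans \<phi> i j = trans_coord (\<phi> i) ` (chart_dom (\<phi> i) \<inter> chart_dom (\<phi> j))"

definition plaques_meet ::
  "(nat \<Rightarrow> ('a, 'n::finite, 'x) fol_chart) \<Rightarrow> nat \<Rightarrow> nat \<Rightarrow> 'x \<Rightarrow> 'x \<Rightarrow> bool" where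
  "plaques_meet \<phi> i j w w' \<longleftrightarrow>
     (\<exists>z \<in> chart_dom (\<phi> i) \<inter> chart_dom (\<phi> j).
        trans_coord (\<phi> i) z = w \<and> trans_coord (\<phi> j) z = w')"

definition transition_holonomy ::
  "(nat \<Rightarrow> ('a, 'n::finite, 'x) fol_chart) \<Rightarrow> nat \<Rightarrow> nat \<Rightarrow> 'x \<Rightarrow> 'x" where
  "transition_holonomy \<phi> i j w = (THE w'. plaques_meet \<phi> i j w w')"

(* The charts phi 0, ..., phi (nu - 1) belong to the smooth structure given by the atlas A but need
   not be members of A.  The diameters of the charts are bounded by the given number e, measured in
   the metric dM.  The last clause is the requirement that the intersection of plaques defines a
   homeomorphism between the overlap transversals. *)
definition regular_covering ::
  "'a topology \<Rightarrow> 'x topology \<Rightarrow> ('a, 'n::finite, 'x) fol_chart set \<Rightarrow> ('a, 'n, 'x) leaf_metric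
     \<Rightarrow> ('a \<Rightarrow> 'a \<Rightarrow> real) \<Rightarrow> real \<Rightarrow> nat \<Rightarrow> (nat \<Rightarrow> ('a, 'n, 'x) fol_chart) \<Rightarrow> bool" where
  "regular_covering M X A G dM e \<nu> \<phi> \<longleftrightarrow>
     (\<forall>i<\<nu>. foliated_chart M X A (\<phi> i) \<and>
        openin X (chart_trans (\<phi> i)) \<and> closedin X (chart_trans (\<phi> i)) \<and>
        (\<forall>c\<in>A. smooth_transition M X (\<phi> i) c \<and> smooth_transition M X c (\<phi> i))) \<and>
     (\<Union>i<\<nu>. chart_dom (\<phi> i)) = topspace M \<and>
     (\<forall>i<\<nu>. \<forall>p \<in> M closure_of chart_dom (\<phi> i). \<forall>q \<in> M closure_of chart_dom (\<phi> i). dM p q < e) \<and>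
     (\<exists>r \<delta>. 0 < \<delta> \<and> \<delta> < r / 5 \<and>
        (\<forall>x\<in>topspace M. strongly_convex M A G (leaf_ball M A G x r)) \<and>
        (\<forall>i<\<nu>. \<forall>w\<in>chart_trans (\<phi> i).
           let x = chart_inv M (\<phi> i) (0, w); P = plaque M (\<phi> i) w in
           strongly_convex M A G P \<and>
           leaf_ball M A G x (\<delta> / 2) \<subseteq> P \<and> P \<subseteq> leaf_ball M A G x \<delta>)) \<and>
     (\<forall>i<\<nu>. \<forall>j<\<nu>.
        openin (subtopology X (chart_trans (\<phi> i))) (overlap_trans \<phi> i j) \<and>
        closedin (subtopology X (chart_trans (\<phi> i))) (overlap_trans \<phi> i j)) \<and>
     (\<forall>i<\<nu>. \<forall>j<\<nu>. chart_dom (\<phi> i) \<inter> chart_dom (\<phi> j) \<noteq> {} \<longrightarrow>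
        (\<forall>w\<in>overlap_trans \<phi> i j. \<exists>!w'. plaques_meet \<phi> i j w w') \<and>
        homeomorphic_map (subtopology X (overlap_trans \<phi> i j))
          (subtopology X (overlap_trans \<phi> j i)) (transition_holonomy \<phi> i j))"

(* The disjoint union of the transversals; its points are pairs (i, w). *)
definition transversal_space ::
  "'x topology \<Rightarrow> nat \<Rightarrow> (nat \<Rightarrow> ('a, 'n::finite, 'x) fol_chart) \<Rightarrow> (nat \<times> 'x) topology" where
  "transversal_space X \<nu> \<phi> = sum_topology (\<lambda>i. subtopology X (chart_trans (\<phi> i))) {..<\<nu>}"

definition holonomy_generator ::
  "(nat \<Rightarrow> ('a, 'n::finite, 'x) fol_chart) \<Rightarrow> nat \<Rightarrow> nat \<Rightarrow> (nat \<times> 'x) \<rightharpoonup> (nat \<times> 'x)" where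
  "holonomy_generator \<phi> i j =
     (\<lambda>(k, w). if k = i \<and> w \<in> overlap_trans \<phi> i j
               then Some (j, transition_holonomy \<phi> i j w) else None)"

definition holonomy_generators ::
  "nat \<Rightarrow> (nat \<Rightarrow> ('a, 'n::finite, 'x) fol_chart) \<Rightarrow> ((nat \<times> 'x) \<rightharpoonup> (nat \<times> 'x)) set" where
  "holonomy_generators \<nu> \<phi> =
     {holonomy_generator \<phi> i j | i j.
        i < \<nu> \<and> j < \<nu> \<and> chart_dom (\<phi> i) \<inter> chart_dom (\<phi> j) \<noteq> {}}"


section \<open>Geometric entropy\<close>

(* Compositions of exactly k generators; map composition of partial maps has the maximal domain. *)
primrec compositions :: "('p \<rightharpoonup> 'p) set \<Rightarrow> nat \<Rightarrow> ('p \<rightharpoonup> 'p) set" where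
  "compositions S 0 = {Some}"
| "compositions S (Suc k) = {s \<circ>\<^sub>m g | s g. s \<in> S \<and> g \<in> compositions S k}"

definition pseudo_star :: "('p \<rightharpoonup> 'p) set \<Rightarrow> ('p \<rightharpoonup> 'p) set" where
  "pseudo_star S = (\<Union>k\<in>{1..}. compositions S k)"

definition word_length :: "('p \<rightharpoonup> 'p) set \<Rightarrow> ('p \<rightharpoonup> 'p) \<Rightarrow> nat" where
  "word_length S g = (LEAST k. 1 \<le> k \<and> g \<in> compositions S k)"

(* Y is the transversal space, with the points (i, w) of its i-th component. *)
definition entropy_separated ::
  "(nat \<times> 'x) topology \<Rightarrow> ((nat \<times> 'x) \<rightharpoonup> (nat \<times> 'x)) set \<Rightarrow> (nat \<times> 'x \<Rightarrow> nat \<times> 'x \<Rightarrow> real)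
     \<Rightarrow> real \<Rightarrow> real \<Rightarrow> (nat \<times> 'x) set \<Rightarrow> bool" where
  "entropy_separated Y S d \<epsilon> l E \<longleftrightarrow>
     E \<subseteq> topspace Y \<and>
     (\<forall>w\<in>E. \<forall>w'\<in>E. w \<noteq> w' \<and> fst w = fst w' \<longrightarrow>
        (\<exists>g\<in>pseudo_star S. w \<in> dom g \<and> w' \<in> dom g \<and>
           dom g \<subseteq> {p \<in> topspace Y. fst p = fst w} \<and>
           real (word_length S g) \<le> l \<and> d (the (g w)) (the (g w')) \<ge> \<epsilon>))"

(* Extended-real valued, so that an unbounded set of cardinalities gives infinity. *)
definition max_separated ::
  "(nat \<times> 'x) topology \<Rightarrow> ((nat \<times> 'x) \<rightharpoonup> (nat \<times> 'x)) set \<Rightarrow> (nat \<times> 'x \<Rightarrow> nat \<times> 'x \<Rightarrow> real)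
     \<Rightarrow> real \<Rightarrow> real \<Rightarrow> ereal" where
  "max_separated Y S d \<epsilon> l =
     (SUP E\<in>{E. finite E \<and> entropy_separated Y S d \<epsilon> l E}. ereal (real (card E)))"

definition ln_extended :: "ereal \<Rightarrow> ereal" where
  "ln_extended r = (if r = \<infinity> then \<infinity> else ereal (ln (real_of_ereal r)))"

definition entropy_at_scale ::
  "(nat \<times> 'x) topology \<Rightarrow> ((nat \<times> 'x) \<rightharpoonup> (nat \<times> 'x)) set \<Rightarrow> (nat \<times> 'x \<Rightarrow> nat \<times> 'x \<Rightarrow> real)
     \<Rightarrow> real \<Rightarrow> ereal" where
  "entropy_at_scale Y S d \<epsilon> =
     Limsup at_top (\<lambda>l::real. ln_extended (max_separated Y S d \<epsilon> l) / ereal l)"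

definition geometric_entropy ::
  "(nat \<times> 'x) topology \<Rightarrow> ((nat \<times> 'x) \<rightharpoonup> (nat \<times> 'x)) set \<Rightarrow> (nat \<times> 'x \<Rightarrow> nat \<times> 'x \<Rightarrow> real)
     \<Rightarrow> ereal" where
  "geometric_entropy Y S d = Lim (at_right 0) (entropy_at_scale Y S d)"


section \<open>Foliations of class C1 on manifolds\<close>

(* A foliated chart of a manifold of dimension CARD('m) is an open set with a homeomorphism to an
   open subset of real^'m.  The coordinates with index in J are the leaf coordinates, the other
   ones are the transverse coordinates; so the leaf dimension is card J. *)
type_synonym ('b, 'm) mfd_chart = "'b set \<times> ('b \<Rightarrow> real ^ 'm)"

definition same_transverse :: "'m set \<Rightarrow> real ^ 'm \<Rightarrow> real ^ 'm::finite \<Rightarrow> bool" where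
  "same_transverse J x y \<longleftrightarrow> (\<forall>i. i \<notin> J \<longrightarrow> x $ i = y $ i)"

definition C1_foliation ::
  "'b topology \<Rightarrow> 'm set \<Rightarrow> ('b, 'm::finite) mfd_chart set \<Rightarrow> bool" where
  "C1_foliation N J B \<longleftrightarrow>
     Hausdorff_space N \<and> second_countable N \<and>
     (\<forall>(V, \<psi>)\<in>B. openin N V \<and> open (\<psi> ` V) \<and>
        homeomorphic_map (subtopology N V) (top_of_set (\<psi> ` V)) \<psi>) \<and>
     (\<Union>(V, \<psi>)\<in>B. V) = topspace N \<and>
     (\<forall>(V, \<psi>)\<in>B. \<forall>(V', \<psi>')\<in>B.
        let \<tau> = (\<lambda>x. \<psi>' (inv_into V \<psi> x)); D = \<psi> ` (V \<inter> V') in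
        C1_on \<tau> D \<and>
        (\<forall>z\<in>D. \<exists>O'. open O' \<and> z \<in> O' \<and> O' \<subseteq> D \<and>
           (\<forall>x\<in>O'. \<forall>y\<in>O'. same_transverse J x y \<longrightarrow> same_transverse J (\<tau> x) (\<tau> y))))"

definition mfd_leaf_topology :: "'m set \<Rightarrow> ('b, 'm::finite) mfd_chart set \<Rightarrow> 'b topology" where
  "mfd_leaf_topology J B = topology_generated_by
     {{p \<in> V. \<psi> p \<in> O' \<and> same_transverse J (\<psi> p) a} | V \<psi> O' a. (V, \<psi>) \<in> B \<and> open O'}"

definition mfd_leaves :: "'m set \<Rightarrow> ('b, 'm::finite) mfd_chart set \<Rightarrow> 'b set set" where
  "mfd_leaves J B = connected_components_of (mfd_leaf_topology J B)"

definition invariant_set :: "'m set \<Rightarrow> ('b, 'm::finite) mfd_chart set \<Rightarrow> 'b set \<Rightarrow> bool" where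
  "invariant_set J B Z \<longleftrightarrow> (\<exists>\<L>. \<L> \<subseteq> mfd_leaves J B \<and> Z = \<Union>\<L>)"

end

theory Submission
  imports Defs
begin

text \<open>
  Suppose that \<open>f\<close> maps \<open>M\<close> homeomorphically onto an invariant set \<open>Z\<close> of a \<open>C\<^sup>1\<close>-foliation.
  In a small foliated box of the manifold, \<open>Z\<close> is a union of full plaques, and since the
  transversals of \<open>M\<close> are totally disconnected, \<open>f\<close> identifies the plaques of \<open>M\<close> with those of
  the box.  So the transverse coordinates of the box restrict to an embedding of a piece of the
  transversal of \<open>M\<close> into Euclidean space, and because the coordinate changes of the foliation
  are \<open>C\<^sup>1\<close>, all holonomy generators are locally Lipschitz in these coordinates.  By compactness
  finitely many pieces suffice, which gives an injective continuous map \<open>\<Theta>\<close> of the whole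
  transversal into a Euclidean space for which all generators are \<open>L\<close>-Lipschitz.  Points that are
  separated by a word of length \<open>l\<close> then have \<open>\<Theta>\<close>-distance at least \<open>\<delta> / L powr l\<close>, and a bounded
  set of dimension \<open>D\<close> contains at most \<open>(a * L powr l) powr D\<close> such points.  Hence the entropy at
  every scale is at most \<open>D * (1 + ln L)\<close>, independently of the scale.
\<close>

section \<open>Entropy of Lipschitz pseudogroups\<close>

text \<open>As \<open>f\<close> is only a homeomorphism, nothing can be estimated in the coordinates
  of \<open>M\<close>. All bounds are taken in transverse coordinates of boxes of the manifold, and
  a generator is followed along plaques from box to box, each change of box costing one constant.
  This needs the identification of plaques in both directions. That a box plaque lies in a plaque of
  \<open>M\<close> follows from total disconnectedness; that a plaque of \<open>M\<close> locally
  stays in a box plaque needs equal leaf dimensions, through invariance of domain.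

  The first component of \<open>\<Theta>\<close> is the index of the piece of the transversal. It
  keeps different pieces at distance at least 1, so injectivity need only hold on each piece, and
  points of different components, which are separated by default, are far apart as well.

  The scale enters through the uniform continuity of the inverse of \<open>\<Theta>\<close>. It
  affects the factor \<open>a\<close> but not the growth rate \<open>L\<close>, and once
  \<open>l\<close> is at least \<open>ln a\<close> the factor costs only the summand 1 in the
  bound.\<close>

lemma card_separated_le:
  fixes F :: "'e::euclidean_space set"
  assumes F: "finite F" and R: "\<And>x. x \<in> F \<Longrightarrow> norm x \<le> R"
    and sep: "\<And>x y. x \<in> F \<Longrightarrow> y \<in> F \<Longrightarrow> x \<noteq> y \<Longrightarrow> dist x y \<ge> \<eta>"
    and eta: "\<eta> > 0" and "R \<ge> 0"
  shows "real (card F) \<le> (2 * R * DIM('e) / \<eta> + 3) ^ DIM('e)"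
proof -
  \<comment> \<open>The mesh of the grid is \<open>\<eta> / DIM('e)\<close>: two points in one cell
    are less than \<open>\<eta>\<close> apart in the l1 norm, which dominates the Euclidean norm. So
    a cell holds at most one point of \<open>F\<close>.\<close>
  define c where "c = DIM('e) / \<eta>"
  have c: "c > 0" using eta by (simp add: c_def)
  define I where "I = {\<lfloor>- (R * c)\<rfloor>..\<lfloor>R * c\<rfloor>}"
  define cell where "cell x = (\<lambda>b\<in>Basis. \<lfloor>(x \<bullet> b) * c\<rfloor>)" for x :: 'e
  have inj: "inj_on cell F"
  proof (rule inj_onI, rule ccontr)
    fix x y assume xy: "x \<in> F" "y \<in> F" "cell x = cell y" "x \<noteq> y"
    have "\<bar>(x - y) \<bullet> b\<bar> < 1 / c" if "b \<in> Basis" for b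
    proof -
      have "cell x b = cell y b" using xy by simp
      then have "\<lfloor>(x \<bullet> b) * c\<rfloor> = \<lfloor>(y \<bullet> b) * c\<rfloor>" using that by (simp add: cell_def)
      then have "\<bar>(x \<bullet> b) * c - (y \<bullet> b) * c\<bar> < 1" by linarith
      then have "\<bar>(x - y) \<bullet> b\<bar> * c < 1"
        using c abs_mult[of "(x - y) \<bullet> b" c] by (simp add: inner_diff_left left_diff_distrib)
      then show ?thesis using c by (simp add: field_simps)
    qed
    then have "(\<Sum>b\<in>Basis. \<bar>(x - y) \<bullet> b\<bar>) < (\<Sum>b\<in>(Basis::'e set). 1 / c)"
      by (intro sum_strict_mono) auto
    also have "\<dots> = \<eta>" by (simp add: c_def)
    finally have "norm (x - y) < \<eta>" using norm_le_l1[of "x - y"] by linarith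
    then show False using sep[OF xy(1,2,4)] by (simp add: dist_norm)
  qed
  have "cell ` F \<subseteq> Basis \<rightarrow>\<^sub>E I"
  proof (rule image_subsetI)
    fix x assume x: "x \<in> F"
    have "\<lfloor>(x \<bullet> b) * c\<rfloor> \<in> I" if "b \<in> Basis" for b
    proof -
      have "\<bar>x \<bullet> b\<bar> \<le> R" using Basis_le_norm[OF that, of x] R[OF x] by linarith
      then have "x \<bullet> b * c \<le> R * c" "(- R) * c \<le> x \<bullet> b * c"
        using c by (intro mult_right_mono; linarith)+
      then show ?thesis unfolding I_def by (auto intro!: floor_mono)
    qed
    then show "cell x \<in> Basis \<rightarrow>\<^sub>E I" by (auto simp: cell_def)
  qed
  moreover have "finite (Basis \<rightarrow>\<^sub>E I :: ('e \<Rightarrow> int) set)"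
    by (intro finite_PiE) (auto simp: I_def)
  ultimately have "card F \<le> card (Basis \<rightarrow>\<^sub>E I :: ('e \<Rightarrow> int) set)"
    using card_inj_on_le[OF inj] by blast
  also have "\<dots> = card I ^ DIM('e)" by (simp add: card_PiE)
  finally have "real (card F) \<le> real (card I) ^ DIM('e)"
    by (metis of_nat_le_iff of_nat_power)
  also have "\<dots> \<le> (2 * R * DIM('e) / \<eta> + 3) ^ DIM('e)"
  proof (intro power_mono)
    have "R * c \<ge> 0" using c assms by simp
    then have "real (card I) \<le> 2 * (R * c) + 3" unfolding I_def by simp linarith
    then show "real (card I) \<le> 2 * R * DIM('e) / \<eta> + 3" by (simp add: c_def mult.assoc)
  qed simp
  finally show ?thesis .
qed

lemma compositions_Lipschitz:
  fixes \<Theta> :: "'p \<Rightarrow> 'e::real_normed_vector"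
  assumes lip: "\<And>s u v. s \<in> S \<Longrightarrow> u \<in> dom s \<Longrightarrow> v \<in> dom s \<Longrightarrow>
      norm (\<Theta> (the (s u)) - \<Theta> (the (s v))) \<le> L * norm (\<Theta> u - \<Theta> v)"
    and L: "L \<ge> 0"
    and g: "g \<in> compositions S k" and u: "u \<in> dom g" and v: "v \<in> dom g"
  shows "norm (\<Theta> (the (g u)) - \<Theta> (the (g v))) \<le> L ^ k * norm (\<Theta> u - \<Theta> v)"
  using g u v
proof (induction k arbitrary: g)
  case 0
  then show ?case by simp
next
  case (Suc k)
  then obtain s h where s: "s \<in> S" and h: "h \<in> compositions S k" and g: "g = s \<circ>\<^sub>m h"
    by auto
  have du: "u \<in> dom h" "the (h u) \<in> dom s" and dv: "v \<in> dom h" "the (h v) \<in> dom s"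
    using Suc.prems(2,3) by (auto simp: g map_comp_def split: option.splits)
  have gu: "g u = s (the (h u))" and gv: "g v = s (the (h v))"
    using du dv by (auto simp: g map_comp_def)
  have "norm (\<Theta> (the (g u)) - \<Theta> (the (g v))) \<le> L * norm (\<Theta> (the (h u)) - \<Theta> (the (h v)))"
    unfolding gu gv by (rule lip[OF s du(2) dv(2)])
  also have "\<dots> \<le> L * (L ^ k * norm (\<Theta> u - \<Theta> v))"
    by (intro mult_left_mono Suc.IH h du(1) dv(1) L)
  finally show ?case by (simp add: mult.assoc)
qed

text \<open>The membership of \<open>u\<close> in \<open>D\<close> serves the empty word, which is
  the identity \<open>Some\<close> on the whole type; for longer words the outermost generator
  decides.\<close>

lemma compositions_ran:
  assumes ran: "\<And>s. s \<in> S \<Longrightarrow> ran s \<subseteq> D"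
    and "g \<in> compositions S k" "u \<in> dom g" "u \<in> D"
  shows "the (g u) \<in> D"
proof (cases k)
  case 0
  then show ?thesis using assms by simp
next
  case (Suc j)
  then obtain s h where s: "s \<in> S" and g: "g = s \<circ>\<^sub>m h" using assms(2) by auto
  have "the (g u) \<in> ran s"
    using assms(3) by (auto simp: g map_comp_def ran_def split: option.splits)
  then show ?thesis using ran[OF s] by blast
qed

text \<open>The pairs at \<open>d\<close>-distance at least \<open>\<epsilon>\<close> form a compact
  set off the diagonal, on which the continuous function
  \<open>dist (\<Theta> u) (\<Theta> v)\<close> is positive and so has a positive minimum. This
  trades the given metric for Euclidean distance.\<close>

lemma compact_uniform_inverse:
  fixes \<Theta> :: "'y \<Rightarrow> 'e::metric_space"
  assumes Y: "compact_space Y" and d: "metric_for Y d"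
    and \<Theta>: "continuous_map Y euclidean \<Theta>" and inj: "inj_on \<Theta> (topspace Y)" and "\<epsilon> > 0"
  obtains \<delta> where "\<delta> > 0"
    "\<And>u v. u \<in> topspace Y \<Longrightarrow> v \<in> topspace Y \<Longrightarrow> dist (\<Theta> u) (\<Theta> v) < \<delta> \<Longrightarrow> d u v < \<epsilon>"
proof -
  interpret Metric_space "topspace Y" d using d by (simp add: metric_for_def)
  have top: "mtopology = Y" using d by (simp add: metric_for_def)
  define P where "P = prod_topology Y Y"
  have contd: "continuous_map P euclideanreal (\<lambda>p. d (fst p) (snd p))"
  proof -
    have "continuous_map P (mtopology_of (metric (topspace Y, d))) fst"
      "continuous_map P (mtopology_of (metric (topspace Y, d))) snd"
      by (simp_all add: P_def mtopology_of_def top continuous_map_fst continuous_map_snd)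
    from continuous_map_mdist[OF this] show ?thesis by simp
  qed
  have contT: "continuous_map P euclideanreal (\<lambda>p. dist (\<Theta> (fst p)) (\<Theta> (snd p)))"
  proof -
    have "continuous_map P (prod_topology euclidean euclidean) (\<lambda>p. (\<Theta> (fst p), \<Theta> (snd p)))"
      unfolding P_def
      by (intro continuous_map_paired[THEN iffD2] conjI
          continuous_map_compose[OF continuous_map_fst \<Theta>, unfolded comp_def]
          continuous_map_compose[OF continuous_map_snd \<Theta>, unfolded comp_def])
    moreover have "continuous_map euclidean euclideanreal (\<lambda>p::'e\<times>'e. dist (fst p) (snd p))"
      by (auto intro!: continuous_intros)
    ultimately show ?thesis
      using continuous_map_compose[of P _ "\<lambda>p. (\<Theta> (fst p), \<Theta> (snd p))" euclideanreal "\<lambda>p. dist (fst p) (snd p)"]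
      by (simp add: comp_def)
  qed
  define K where "K = {p \<in> topspace P. d (fst p) (snd p) \<in> {\<epsilon>..}}"
  have "closedin P K" unfolding K_def
    by (rule closedin_continuous_map_preimage[OF contd]) simp
  then have "compactin P K"
    using Y closedin_compact_space unfolding P_def by (metis compact_space_prod_topology)
  then have cK: "compact ((\<lambda>p. dist (\<Theta> (fst p)) (\<Theta> (snd p))) ` K)"
    using image_compactin[OF _ contT] by (metis compactin_euclidean_iff)
  have pos: "dist (\<Theta> (fst p)) (\<Theta> (snd p)) > 0" if "p \<in> K" for p
  proof -
    have "fst p \<in> topspace Y" "snd p \<in> topspace Y" "d (fst p) (snd p) \<ge> \<epsilon>"
      using that by (auto simp: K_def P_def)
    then show ?thesis using inj \<open>\<epsilon> > 0\<close> by (auto simp: inj_on_eq_iff)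
  qed
  obtain \<delta> where "\<delta> > 0" and \<delta>: "\<And>p. p \<in> K \<Longrightarrow> dist (\<Theta> (fst p)) (\<Theta> (snd p)) \<ge> \<delta>"
  proof (cases "K = {}")
    case True
    then show ?thesis using that[of 1] by auto
  next
    case False
    then obtain s where "s \<in> (\<lambda>p. dist (\<Theta> (fst p)) (\<Theta> (snd p))) ` K"
      "\<And>t. t \<in> (\<lambda>p. dist (\<Theta> (fst p)) (\<Theta> (snd p))) ` K \<Longrightarrow> s \<le> t"
      using compact_attains_inf[OF cK] by blast
    then show ?thesis using pos that[of s] by blast
  qed
  show ?thesis
  proof (rule that[OF \<open>\<delta> > 0\<close>], rule ccontr)
    fix u v assume "u \<in> topspace Y" "v \<in> topspace Y" "dist (\<Theta> u) (\<Theta> v) < \<delta>" "\<not> d u v < \<epsilon>"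
    then show False using \<delta>[of "(u, v)"] by (auto simp: K_def P_def)
  qed
qed

section \<open>Monotonicity in the scale and existence of the entropy limit\<close>

lemma max_separated_nonneg: "0 \<le> max_separated Y S d \<epsilon> l"
proof -
  show ?thesis
    unfolding max_separated_def
    by (rule SUP_upper2[of "{}"]) (auto simp: entropy_separated_def zero_ereal_def)
qed

text \<open>Excludes values strictly between 0 and 1, where \<open>ln\<close> is negative and the
  convention \<open>ln 0 = 0\<close> would spoil monotonicity.\<close>

lemma max_separated_zero_or_ge_1:
  "max_separated Y S d \<epsilon> l = 0 \<or> 1 \<le> max_separated Y S d \<epsilon> l"
proof (cases "\<forall>E\<in>{E. finite E \<and> entropy_separated Y S d \<epsilon> l E}. card E = 0")
  case True
  then have "max_separated Y S d \<epsilon> l \<le> 0"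
    unfolding max_separated_def by (intro SUP_least) (simp add: zero_ereal_def)
  then show ?thesis using max_separated_nonneg[of Y S d \<epsilon> l] by simp
next
  case False
  then obtain E where E: "finite E" "entropy_separated Y S d \<epsilon> l E" "card E \<noteq> 0" by blast
  have "1 \<le> ereal (real (card E))" using E(3) by (simp add: one_ereal_def)
  also have "\<dots> \<le> max_separated Y S d \<epsilon> l"
    unfolding max_separated_def using E by (intro SUP_upper) auto
  finally show ?thesis by simp
qed

text \<open>The value 0 is admissible because \<open>ln 0 = 0\<close>.\<close>

lemma ln_extended_mono:
  assumes "x = 0 \<or> 1 \<le> x" "x \<le> y" "y = 0 \<or> 1 \<le> y" shows "ln_extended x \<le> ln_extended y"
proof (cases x; cases y)
  fix a b assume ab: "x = ereal a" "y = ereal b"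
  have "ln a \<le> ln b"
    using assms ab by (auto simp: zero_ereal_def one_ereal_def)
  then show ?thesis by (simp add: ab ln_extended_def)
qed (use assms in \<open>auto simp: ln_extended_def\<close>)

lemma max_separated_antimono:
  "\<epsilon> \<le> \<epsilon>' \<Longrightarrow> max_separated Y S d \<epsilon>' l \<le> max_separated Y S d \<epsilon> l"
  unfolding max_separated_def
proof (rule SUP_subset_mono)
  assume le: "\<epsilon> \<le> \<epsilon>'"
  show "{E. finite E \<and> entropy_separated Y S d \<epsilon>' l E} \<subseteq> {E. finite E \<and> entropy_separated Y S d \<epsilon> l E}"
  proof clarify
    fix E assume E: "entropy_separated Y S d \<epsilon>' l E"
    show "entropy_separated Y S d \<epsilon> l E"
      unfolding entropy_separated_def
    proof (intro conjI ballI impI)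
      show "E \<subseteq> topspace Y" using E by (simp add: entropy_separated_def)
    next
      fix u v assume uv: "u \<in> E" "v \<in> E" "u \<noteq> v \<and> fst u = fst v"
      then obtain g where "g \<in> pseudo_star S" "u \<in> dom g" "v \<in> dom g"
        "dom g \<subseteq> {p \<in> topspace Y. fst p = fst u}"
        "real (word_length S g) \<le> l" "\<epsilon>' \<le> d (the (g u)) (the (g v))"
        using E unfolding entropy_separated_def by meson
      then show "\<exists>g\<in>pseudo_star S. u \<in> dom g \<and> v \<in> dom g \<and>
          dom g \<subseteq> {p \<in> topspace Y. fst p = fst u} \<and>
          real (word_length S g) \<le> l \<and> \<epsilon> \<le> d (the (g u)) (the (g v))"
        using le by (intro bexI[of _ g]) auto
    qed
  qed
qed simp

lemma entropy_at_scale_antimono: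
  assumes "\<epsilon> \<le> \<epsilon>'" 
  shows "entropy_at_scale Y S d \<epsilon>' \<le> entropy_at_scale Y S d \<epsilon>"
  unfolding entropy_at_scale_def
proof (rule Limsup_mono)
  show "\<forall>\<^sub>F l in at_top. ln_extended (max_separated Y S d \<epsilon>' l) / ereal l
      \<le> ln_extended (max_separated Y S d \<epsilon> l) / ereal l"
    using eventually_gt_at_top[of 0]
  proof eventually_elim
    case (elim l)
    show ?case
    proof (rule ereal_divide_right_mono)
      show "ln_extended (max_separated Y S d \<epsilon>' l) \<le> ln_extended (max_separated Y S d \<epsilon> l)"
        by (intro ln_extended_mono max_separated_zero_or_ge_1 max_separated_antimono assms)
    qed (use elim in simp)
  qed
qed

text \<open>\<open>Lim\<close> says something only once convergence is known. The entropy grows as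
  the scale shrinks, so it converges at 0 to its supremum.\<close>

lemma geometric_entropy_le:
  assumes "\<And>\<epsilon>. \<epsilon> > 0 \<Longrightarrow> entropy_at_scale Y S d \<epsilon> \<le> C"
  shows "geometric_entropy Y S d \<le> C"
proof -
  let ?f = "entropy_at_scale Y S d"
  let ?s = "SUP \<epsilon>\<in>{0<..}. ?f \<epsilon>"
  have "(?f \<longlongrightarrow> ?s) (at_right 0)"
  proof (rule order_tendstoI)
    fix a assume "a < ?s"
    then obtain \<epsilon> where \<epsilon>: "\<epsilon> > 0" "a < ?f \<epsilon>" by (auto simp: less_SUP_iff)
    show "\<forall>\<^sub>F x in at_right 0. a < ?f x"
      unfolding eventually_at_right_field
      using \<epsilon> entropy_at_scale_antimono[of _ \<epsilon> Y S d] by (meson less_imp_le less_le_trans)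
  next
    fix a assume "?s < a"
    then have "?f x < a" if "x > 0" for x using that by (meson SUP_lessD greaterThan_iff)
    then show "\<forall>\<^sub>F x in at_right 0. ?f x < a"
      by (auto simp: eventually_at_right_field intro!: exI[of _ 1])
  qed
  then have "geometric_entropy Y S d = ?s"
    unfolding geometric_entropy_def by (intro tendsto_Lim) auto
  also have "\<dots> \<le> C" using assms by (intro SUP_least) auto
  finally show ?thesis .
qed

text \<open>Points with different first components count as separated without any word, so the
  expansion bound for words says nothing about them; \<open>sep\<close> takes its place.\<close>

lemma Lipschitz_imp_finite_entropy:
  fixes \<Theta> :: "nat \<times> 'x \<Rightarrow> 'e::euclidean_space"
  assumes Y: "compact_space Y" and d: "metric_for Y d"
    and \<Theta>: "continuous_map Y euclidean \<Theta>" and inj: "inj_on \<Theta> (topspace Y)"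
    and ran: "\<And>s. s \<in> S \<Longrightarrow> ran s \<subseteq> topspace Y"
    and lip: "\<And>s u v. s \<in> S \<Longrightarrow> u \<in> dom s \<Longrightarrow> v \<in> dom s \<Longrightarrow>
      norm (\<Theta> (the (s u)) - \<Theta> (the (s v))) \<le> L * norm (\<Theta> u - \<Theta> v)"
    and L: "L \<ge> 1"
    and sep: "\<And>u v. u \<in> topspace Y \<Longrightarrow> v \<in> topspace Y \<Longrightarrow> fst u \<noteq> fst v \<Longrightarrow> norm (\<Theta> u - \<Theta> v) \<ge> 1"
  shows "geometric_entropy Y S d \<noteq> \<infinity>"
proof -
  define D where "D = real DIM('e)"
  have D1: "D \<ge> 1" by (simp add: D_def Suc_le_eq)
  have "compact (\<Theta> ` topspace Y)"
    using image_compactin[OF Y[unfolded compact_space_def] \<Theta>] by simp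
  then obtain R0 where R0: "\<And>x. x \<in> \<Theta> ` topspace Y \<Longrightarrow> norm x \<le> R0"
    using compact_imp_bounded bounded_iff by metis
  define R where "R = max R0 0"
  have R: "R \<ge> 0" "\<And>x. x \<in> \<Theta> ` topspace Y \<Longrightarrow> norm x \<le> R" using R0 by (fastforce simp: R_def)+
  have scale: "entropy_at_scale Y S d \<epsilon> \<le> ereal (D * (1 + ln L))" if \<epsilon>: "\<epsilon> > 0" for \<epsilon>
  proof -
    obtain \<delta>0 where \<delta>0: "\<delta>0 > 0"
      "\<And>u v. u \<in> topspace Y \<Longrightarrow> v \<in> topspace Y \<Longrightarrow> dist (\<Theta> u) (\<Theta> v) < \<delta>0 \<Longrightarrow> d u v < \<epsilon>"
      using compact_uniform_inverse[OF Y d \<Theta> inj \<epsilon>] by metis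
    \<comment> \<open>Capping at 1 lets the bound \<open>\<delta> / L powr l\<close> also cover
      points of different components, whose distance is only known to be at least 1.\<close>
    define \<delta> where "\<delta> = min \<delta>0 1"
    have \<delta>: "0 < \<delta>" "\<delta> \<le> 1" "\<delta> \<le> \<delta>0" using \<delta>0 by (auto simp: \<delta>_def)
    define a where "a = 2 * R * D / \<delta> + 3"
    have a: "a \<ge> 3" using R \<delta> D1 by (simp add: a_def)
    have card: "real (card E) \<le> (a * L powr l) powr D"
      if E: "finite E" "entropy_separated Y S d \<epsilon> l E" and l: "l \<ge> 1" for E l
    proof -
      have EY: "E \<subseteq> topspace Y" using E by (simp add: entropy_separated_def)
      have Ll: "L powr l \<ge> 1" using L l by (simp add: ge_one_powr_ge_zero)
      have far: "norm (\<Theta> u - \<Theta> v) \<ge> \<delta> / L powr l" if uv: "u \<in> E" "v \<in> E" "u \<noteq> v" for u v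
      proof (cases "fst u = fst v")
        case False
        then have "norm (\<Theta> u - \<Theta> v) \<ge> 1" using sep uv EY by blast
        moreover have "\<delta> / L powr l \<le> 1" using \<delta> Ll by (simp add: divide_le_eq)
        ultimately show ?thesis by linarith
      next
        case True
        then obtain g where g: "g \<in> pseudo_star S" "u \<in> dom g" "v \<in> dom g"
          "real (word_length S g) \<le> l" "d (the (g u)) (the (g v)) \<ge> \<epsilon>"
          using E uv unfolding entropy_separated_def by blast
        define k where "k = word_length S g"
        have "\<exists>k. 1 \<le> k \<and> g \<in> compositions S k" using g(1) by (auto simp: pseudo_star_def)
        then have gk: "g \<in> compositions S k" unfolding k_def word_length_def by (rule LeastI2_ex) simp
        have "the (g u) \<in> topspace Y" "the (g v) \<in> topspace Y"
          using compositions_ran[OF ran gk] g uv EY by blast+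
        then have "\<delta>0 \<le> norm (\<Theta> (the (g u)) - \<Theta> (the (g v)))"
          using \<delta>0(2)[of "the (g u)" "the (g v)"] g(5) by (force simp: dist_norm)
        also have "\<dots> \<le> L ^ k * norm (\<Theta> u - \<Theta> v)"
          by (rule compositions_Lipschitz[where S = S]) (use L lip gk g in auto)
        also have "\<dots> \<le> L powr l * norm (\<Theta> u - \<Theta> v)"
          using L g(4) by (intro mult_right_mono) (auto simp: k_def powr_mono simp flip: powr_realpow)
        finally show ?thesis using \<delta> Ll by (simp add: divide_le_eq mult.commute)
      qed
      have "inj_on \<Theta> E" using inj EY by (rule inj_on_subset)
      then have "real (card E) = real (card (\<Theta> ` E))" by (simp add: card_image)
      also have "\<dots> \<le> (2 * R * D / (\<delta> / L powr l) + 3) ^ DIM('e)"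
        unfolding D_def
      proof (rule card_separated_le)
        fix x y assume "x \<in> \<Theta> ` E" "y \<in> \<Theta> ` E" "x \<noteq> y"
        then show "\<delta> / L powr l \<le> dist x y" using far by (auto simp: dist_norm)
      next
        show "0 < \<delta> / L powr l" using \<delta> Ll by (intro divide_pos_pos) auto
      qed (use E EY R in auto)
      also have "\<dots> \<le> (a * L powr l) ^ DIM('e)"
        using R \<delta> D1 Ll by (intro power_mono) (auto simp: a_def algebra_simps)
      also have "\<dots> = (a * L powr l) powr D"
        unfolding D_def using a Ll by (subst powr_realpow) (auto intro!: mult_pos_pos)
      finally show ?thesis .
    qed
    show ?thesis
      unfolding entropy_at_scale_def
    proof (rule Limsup_bounded)
      show "\<forall>\<^sub>F l in at_top. ln_extended (max_separated Y S d \<epsilon> l) / ereal l \<le> ereal (D * (1 + ln L))"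
        \<comment> \<open>From \<open>l \<ge> ln a\<close> the scale-dependent term is absorbed:
          \<open>ln a + l * ln L \<le> (1 + ln L) * l\<close>. The bound by 1 is for the counting
          estimate and for dividing by \<open>l\<close>.\<close>
        using eventually_ge_at_top[of "max 1 (ln a)"]
      proof eventually_elim
        case (elim l)
        have Ll: "L powr l \<ge> 1" using L elim by (simp add: ge_one_powr_ge_zero)
        have "max_separated Y S d \<epsilon> l \<le> ereal ((a * L powr l) powr D)"
          unfolding max_separated_def using card elim by (intro SUP_least) auto
        then have "ln_extended (max_separated Y S d \<epsilon> l) \<le> ln_extended (ereal ((a * L powr l) powr D))"
        proof (intro ln_extended_mono max_separated_zero_or_ge_1)
          show "ereal ((a * L powr l) powr D) = 0 \<or> 1 \<le> ereal ((a * L powr l) powr D)"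
            using a Ll D1 mult_mono[of 1 a 1 "L powr l"]
            by (auto simp: one_ereal_def intro!: ge_one_powr_ge_zero)
        qed
        also have "\<dots> = ereal (D * (ln a + l * ln L))"
          using a L Ll by (simp add: ln_extended_def ln_powr ln_mult)
        also have "\<dots> \<le> ereal (D * (1 + ln L) * l)"
          using elim D1 L by (simp add: algebra_simps)
        finally have *: "ln_extended (max_separated Y S d \<epsilon> l) \<le> ereal (D * (1 + ln L) * l)" .
        have "ln_extended (max_separated Y S d \<epsilon> l) / ereal l \<le> ereal (D * (1 + ln L) * l) / ereal l"
          by (rule ereal_divide_right_mono[OF *]) (use elim in simp)
        then show ?case using elim by simp
      qed
    qed
  qed
  have "geometric_entropy Y S d \<le> ereal (D * (1 + ln L))" by (rule geometric_entropy_le[OF scale])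
  then show ?thesis by auto
qed

section \<open>Clopen partitions and Lipschitz maps on compact spaces\<close>

text \<open>In a compact Hausdorff space quasi-components are components, here single points. So
  each point outside \<open>P\<close> is cut off from \<open>x\<close> by a clopen set, and by
  compactness finitely many of these suffice.\<close>

lemma clopen_basis:
  assumes Y: "compact_space Y" "Hausdorff_space Y" "totally_disconnected_space Y"
    and P: "openin Y P" "x \<in> P"
  obtains C where "openin Y C" "closedin Y C" "x \<in> C" "C \<subseteq> P"
proof -
  have xY: "x \<in> topspace Y" using P openin_subset by blast
  define \<C> where "\<C> = {C. closedin Y C \<and> openin Y C \<and> x \<in> C}"
  have conn: "connected_component_of Y x y \<Longrightarrow> y = x" for y
    using Y(3) unfolding totally_disconnected_space_def connected_component_of_def
    by (metis singleton_iff subset_iff)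
  have "\<exists>C\<in>\<C>. y \<notin> C" if y: "y \<in> topspace Y - P" for y
  proof -
    have "\<not> quasi_component_of Y x y"
      using conn[of y] y P quasi_eq_connected_component_of[of Y x] Y(1,2) by force
    then show ?thesis using y xY unfolding quasi_component_of_def \<C>_def by blast
  qed
  then have cover: "topspace Y - P \<subseteq> \<Union>((\<lambda>C. topspace Y - C) ` \<C>)" by blast
  have "compactin Y (topspace Y - P)"
    using Y(1) P by (intro closedin_compact_space) auto
  moreover have "\<forall>U\<in>(\<lambda>C. topspace Y - C) ` \<C>. openin Y U" by (auto simp: \<C>_def)
  ultimately obtain \<F> where \<F>: "finite \<F>" "\<F> \<subseteq> (\<lambda>C. topspace Y - C) ` \<C>" "topspace Y - P \<subseteq> \<Union>\<F>"
    using cover unfolding compactin_def by meson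
  then obtain \<C>' where C': "\<C>' \<subseteq> \<C>" "finite \<C>'" "\<F> = (\<lambda>C. topspace Y - C) ` \<C>'"
    by (meson finite_subset_image)
  \<comment> \<open>Inserting the whole space keeps the intersection meaningful when
    \<open>\<C>'\<close> is empty.\<close>
  define C where "C = \<Inter>(insert (topspace Y) \<C>')"
  show ?thesis
  proof (rule that)
    show "openin Y C" unfolding C_def using C' by (intro openin_Inter) (auto simp: \<C>_def)
    show "closedin Y C" unfolding C_def using C' by (intro closedin_Inter) (auto simp: \<C>_def)
    show "x \<in> C" using C' xY by (auto simp: C_def \<C>_def)
    show "C \<subseteq> P" using \<F>(3) C' by (auto simp: C_def)
  qed
qed

text \<open>A finite clopen cover becomes disjoint by sending a point to the first member that
  contains it. The partition is encoded by a continuous index, and \<open>pt\<close> remembers for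
  each index a point whose neighbourhood contains the piece, so that data chosen pointwise can be
  made constant on pieces.\<close>

lemma clopen_partition:
  assumes Y: "compact_space Y" "Hausdorff_space Y" "totally_disconnected_space Y"
    and P: "\<And>x. x \<in> topspace Y \<Longrightarrow> openin Y (P x) \<and> x \<in> P x"
  obtains idx :: "'y \<Rightarrow> nat" and pt :: "nat \<Rightarrow> 'y"
  where "continuous_map Y (discrete_topology UNIV) idx"
    "\<forall>y\<in>topspace Y. pt (idx y) \<in> topspace Y \<and> y \<in> P (pt (idx y))"
proof -
  have "\<exists>C. openin Y C \<and> closedin Y C \<and> x \<in> C \<and> C \<subseteq> P x" if "x \<in> topspace Y" for x
    using clopen_basis[OF Y] P[OF that] by metis
  then obtain C where C: "\<And>x. x \<in> topspace Y \<Longrightarrow> openin Y (C x) \<and> closedin Y (C x) \<and> x \<in> C x \<and> C x \<subseteq> P x"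
    by metis
  have "\<forall>U\<in>C ` topspace Y. openin Y U" "topspace Y \<subseteq> \<Union>(C ` topspace Y)" using C by auto
  then have "\<exists>F. finite F \<and> F \<subseteq> C ` topspace Y \<and> topspace Y \<subseteq> \<Union>F"
    using Y(1) unfolding compact_space_def compactin_def by meson
  then obtain F where F: "finite F" "F \<subseteq> topspace Y" "topspace Y \<subseteq> (\<Union>x\<in>F. C x)"
    by (metis finite_subset_image)
  obtain xs where xs: "set xs = F" using F(1) finite_list by blast
  define idx where "idx y = (LEAST k. k < length xs \<and> y \<in> C (xs ! k))" for y
  have idx: "idx y < length xs \<and> y \<in> C (xs ! idx y)" if "y \<in> topspace Y" for y
  proof -
    have "\<exists>k. k < length xs \<and> y \<in> C (xs ! k)" using F(3) xs that by (metis UN_E in_set_conv_nth subsetD)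
    then show ?thesis unfolding idx_def by (rule LeastI_ex)
  qed
  show ?thesis
  proof (rule that)
    show "\<forall>y\<in>topspace Y. xs ! idx y \<in> topspace Y \<and> y \<in> P (xs ! idx y)"
    proof
      fix y assume y: "y \<in> topspace Y"
      have "xs ! idx y \<in> topspace Y" using idx[OF y] xs F by auto
      then show "xs ! idx y \<in> topspace Y \<and> y \<in> P (xs ! idx y)"
        using idx[OF y] C by blast
    qed
  next
    have eq: "{y \<in> topspace Y. idx y = k} = C (xs ! k) - (\<Union>j<k. C (xs ! j))" if k: "k < length xs" for k
    proof safe
      fix y assume "y \<in> topspace Y" "k = idx y" then show "y \<in> C (xs ! idx y)" using idx by blast
    next
      fix y j assume "y \<in> topspace Y" "k = idx y" "j < idx y" "y \<in> C (xs ! j)"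
      then show False using not_less_Least[of j] k unfolding idx_def by fastforce
    next
      fix y assume y: "y \<in> C (xs ! k)" "y \<notin> (\<Union>j<k. C (xs ! j))"
      show "y \<in> topspace Y" using y C k xs F by (meson closedin_subset nth_mem subsetD)
      show "idx y = k" unfolding idx_def using y k by (intro Least_equality) (auto simp: not_less[symmetric])
    qed
    show "continuous_map Y (discrete_topology UNIV) idx"
    proof (clarsimp simp: continuous_map_def)
      fix U :: "nat set"
      have "openin Y {y \<in> topspace Y. idx y = k}" for k
      proof (cases "k < length xs")
        case True
        have "xs ! j \<in> topspace Y" if "j \<le> k" for j using that True xs F by auto
        then show ?thesis unfolding eq[OF True]
          using C by (intro openin_diff closedin_Union) (auto simp: C)
      next
        case False
        then have "{y \<in> topspace Y. idx y = k} = {}" using idx by auto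
        then show ?thesis by (simp only: openin_empty)
      qed
      then have "openin Y (\<Union>k\<in>U. {y \<in> topspace Y. idx y = k})" by auto
      then show "openin Y {x \<in> topspace Y. idx x \<in> U}" by (rule back_subst[of "openin Y"]) auto
    qed
  qed
qed

text \<open>Near the diagonal of \<open>K \<times> K\<close> the local constants apply. Away from it
  \<open>\<Theta>\<close> separates the two points by a definite amount while \<open>\<psi>\<close>
  is bounded, so the quotient is bounded there too. Finitely many such neighbourhoods cover the
  compact square.\<close>

lemma locally_Lipschitz_imp_Lipschitz:
  fixes \<Theta> :: "'y \<Rightarrow> 'e::real_normed_vector" and \<psi> :: "'y \<Rightarrow> 'f::real_normed_vector"
  assumes K: "compactin Y K" and \<Theta>: "continuous_map Y euclidean \<Theta>" and inj: "inj_on \<Theta> K"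
    and bnd: "bounded (\<psi> ` K)"
    and loc: "\<And>w. w \<in> K \<Longrightarrow> \<exists>W L. openin Y W \<and> w \<in> W \<and>
        (\<forall>u\<in>W \<inter> K. \<forall>v\<in>W \<inter> K. norm (\<psi> u - \<psi> v) \<le> L * norm (\<Theta> u - \<Theta> v))"
  shows "\<exists>L\<ge>1. \<forall>u\<in>K. \<forall>v\<in>K. norm (\<psi> u - \<psi> v) \<le> L * norm (\<Theta> u - \<Theta> v)"
proof -
  have KY: "K \<subseteq> topspace Y" using K by (rule compactin_subset_topspace)
  obtain R where R: "\<And>u. u \<in> K \<Longrightarrow> norm (\<psi> u) \<le> R" using bnd by (auto simp: bounded_iff)
  define good where "good W L \<longleftrightarrow> (\<forall>p\<in>W \<inter> K \<times> K. norm (\<psi> (fst p) - \<psi> (snd p)) \<le> L * norm (\<Theta> (fst p) - \<Theta> (snd p)))" for W and L :: real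
  have "\<exists>W L. openin (prod_topology Y Y) W \<and> p \<in> W \<and> good W L" if p: "p \<in> K \<times> K" for p
  proof -
    obtain a b where ab: "p = (a, b)" "a \<in> K" "b \<in> K" using p by auto
    show ?thesis
    proof (cases "a = b")
      case True
      obtain W L where "openin Y W" "a \<in> W"
        "\<forall>u\<in>W \<inter> K. \<forall>v\<in>W \<inter> K. norm (\<psi> u - \<psi> v) \<le> L * norm (\<Theta> u - \<Theta> v)"
        using loc[OF ab(2)] by blast
      then show ?thesis using ab True
        by (intro exI[of _ "W \<times> W"] exI[of _ L]) (auto simp: good_def openin_prod_Times_iff)
    next
      case False
      \<comment> \<open>With radius one third of the distance, points of the two balls remain at
        least \<open>\<eta>\<close> apart.\<close>
      define \<eta> where "\<eta> = dist (\<Theta> a) (\<Theta> b) / 3"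
      have "\<Theta> a \<noteq> \<Theta> b" using inj False ab by (auto simp: inj_on_def)
      then have \<eta>: "\<eta> > 0" by (simp add: \<eta>_def)
      define Wa where "Wa = {u \<in> topspace Y. \<Theta> u \<in> ball (\<Theta> a) \<eta>}"
      define Wb where "Wb = {u \<in> topspace Y. \<Theta> u \<in> ball (\<Theta> b) \<eta>}"
      have op: "openin Y Wa" "openin Y Wb" unfolding Wa_def Wb_def
        by (rule openin_continuous_map_preimage[OF \<Theta>]; simp)+
      have "good (Wa \<times> Wb) (2 * R / \<eta>)"
        unfolding good_def
      proof clarify
        fix u v assume uv: "u \<in> Wa" "v \<in> Wb" "u \<in> K" "v \<in> K"
        have "dist (\<Theta> a) (\<Theta> b) \<le> dist (\<Theta> a) (\<Theta> u) + dist (\<Theta> u) (\<Theta> v) + dist (\<Theta> v) (\<Theta> b)"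
          by metric
        then have far: "\<eta> \<le> norm (\<Theta> u - \<Theta> v)"
          using uv by (simp add: Wa_def Wb_def \<eta>_def dist_commute flip: dist_norm)
        have R0: "R \<ge> 0" using R[OF uv(3)] norm_ge_zero order_trans by blast
        have "norm (\<psi> u - \<psi> v) \<le> 2 * R"
          using norm_triangle_ineq4[of "\<psi> u" "\<psi> v"] R[OF uv(3)] R[OF uv(4)] by linarith
        also have "\<dots> = 2 * R / \<eta> * \<eta>" using \<eta> by simp
        also have "\<dots> \<le> 2 * R / \<eta> * norm (\<Theta> u - \<Theta> v)"
          using R0 \<eta> by (intro mult_left_mono far) auto
        finally show "norm (\<psi> (fst (u, v)) - \<psi> (snd (u, v))) \<le> 2 * R / \<eta> * norm (\<Theta> (fst (u, v)) - \<Theta> (snd (u, v)))"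
          by simp
      qed
      then show ?thesis using op ab \<eta> KY
        by (intro exI[of _ "Wa \<times> Wb"] exI[of _ "2 * R / \<eta>"]) (auto simp: openin_prod_Times_iff Wa_def Wb_def)
    qed
  qed
  then obtain W L where WL: "\<And>p. p \<in> K \<times> K \<Longrightarrow> openin (prod_topology Y Y) (W p) \<and> p \<in> W p \<and> good (W p) (L p)"
    by metis
  have "compactin (prod_topology Y Y) (K \<times> K)" using K by (simp add: compactin_Times)
  moreover have "\<forall>U\<in>W ` (K \<times> K). openin (prod_topology Y Y) U" "K \<times> K \<subseteq> \<Union>(W ` (K \<times> K))"
    using WL by blast+
  ultimately have "\<exists>F. finite F \<and> F \<subseteq> W ` (K \<times> K) \<and> K \<times> K \<subseteq> \<Union>F"
    unfolding compactin_def by meson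
  then obtain F where F: "finite F" "F \<subseteq> K \<times> K" "K \<times> K \<subseteq> (\<Union>p\<in>F. W p)"
    by (metis finite_subset_image)
  define L' where "L' = Max (insert 1 (L ` F))"
  show ?thesis
  proof (intro exI[of _ L'] conjI ballI)
    show "L' \<ge> 1" unfolding L'_def using F by (intro Max_ge) auto
  next
    fix u v assume uv: "u \<in> K" "v \<in> K"
    then obtain p where p: "p \<in> F" "(u, v) \<in> W p" using F(3) by blast
    have "norm (\<psi> u - \<psi> v) \<le> L p * norm (\<Theta> u - \<Theta> v)"
    proof -
      have "good (W p) (L p)" using WL p(1) F(2) by blast
      then show ?thesis using p(2) uv unfolding good_def by (auto dest!: bspec[where x = "(u, v)"])
    qed
    also have "\<dots> \<le> L' * norm (\<Theta> u - \<Theta> v)"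
      unfolding L'_def using p F by (intro mult_right_mono Max_ge) auto
    finally show "norm (\<psi> u - \<psi> v) \<le> L' * norm (\<Theta> u - \<Theta> v)" .
  qed
qed

section \<open>Transverse coordinates of a foliation\<close>

text \<open>The leaf coordinates are set to 0 instead of being dropped, so no type depending on
  \<open>J\<close> is needed and the projection is a linear endomorphism that does not increase
  norms.\<close>

definition transverse :: "'m set \<Rightarrow> real ^ 'm \<Rightarrow> real ^ 'm::finite" where
  "transverse J x = (\<chi> i. if i \<in> J then 0 else x $ i)"

lemma same_transverse_iff: "same_transverse J x y \<longleftrightarrow> transverse J x = transverse J y"
  by (auto simp: same_transverse_def transverse_def vec_eq_iff)

lemma transverse_diff: "transverse J x - transverse J y = transverse J (x - y)"
  by (simp add: transverse_def vec_eq_iff)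

lemma continuous_on_transverse: "continuous_on S (transverse J)"
  unfolding transverse_def
proof (intro continuous_on_vec_lambda)
  show "continuous_on S (\<lambda>x. if i \<in> J then 0 else x $ i)" for i
    by (cases "i \<in> J") (auto intro!: continuous_intros)
qed

lemma norm_transverse_le: "norm (transverse J x) \<le> norm x"
  by (rule norm_le_componentwise_cart) (simp add: transverse_def)

text \<open>Cubes are convex, as the mean value inequality requires, and are closed under mixing the
  coordinates of two of their points, which Euclidean balls are not.\<close>

definition cube_at :: "real ^ 'm \<Rightarrow> real \<Rightarrow> (real ^ 'm::finite) set" where
  "cube_at a r = {x. \<forall>i. \<bar>x $ i - a $ i\<bar> < r}"

lemma cube_at_eq_box: "cube_at a r = box (\<chi> i. a $ i - r) (\<chi> i. a $ i + r)"
  by (auto simp: cube_at_def mem_box_cart abs_less_iff algebra_simps)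

lemma open_cube_at: "open (cube_at a r)" and convex_cube_at: "convex (cube_at a r)"
  by (simp_all add: cube_at_eq_box open_box)

lemma cube_at_subset:
  fixes a :: "real ^ 'm::finite"
  assumes "open S" "a \<in> S" obtains r where "r > 0" "cube_at a r \<subseteq> S"
proof -
  obtain e where e: "e > 0" "ball a e \<subseteq> S" using assms open_contains_ball by blast
  have "cube_at a (e / CARD('m)) \<subseteq> ball a e"
  proof
    fix x assume x: "x \<in> cube_at a (e / CARD('m))"
    have "norm (x - a) \<le> (\<Sum>i\<in>UNIV. \<bar>(x - a) $ i\<bar>)" by (rule norm_le_l1_cart)
    also have "\<dots> < (\<Sum>i\<in>(UNIV::'m set). e / CARD('m))"
      using x by (intro sum_strict_mono) (auto simp: cube_at_def)
    finally show "x \<in> ball a e" by (simp add: dist_norm norm_minus_commute)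
  qed
  then show ?thesis using e that[of "e / CARD('m)"] by (auto simp: subset_iff)
qed

locale foliated_manifold =
  fixes N :: "'b topology" and J :: "'m::finite set" and B :: "('b, 'm) mfd_chart set"
  assumes fol: "C1_foliation N J B"
begin

context
  fixes V \<psi> assumes V: "(V, \<psi>) \<in> B"
begin

lemma openin_chart: "openin N V" and open_chart_image: "open (\<psi> ` V)"
  and homeo_chart: "homeomorphic_map (subtopology N V) (top_of_set (\<psi> ` V)) \<psi>"
proof -
  have "\<forall>(V, \<psi>)\<in>B. openin N V \<and> open (\<psi> ` V) \<and>
        homeomorphic_map (subtopology N V) (top_of_set (\<psi> ` V)) \<psi>"
    using fol unfolding C1_foliation_def by (elim conjE)
  from bspec[OF this V] show "openin N V" "open (\<psi> ` V)"
    "homeomorphic_map (subtopology N V) (top_of_set (\<psi> ` V)) \<psi>" by simp_all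
qed

lemma inj_chart: "inj_on \<psi> V"
  using homeo_chart openin_chart openin_subset
  by (metis homeomorphic_imp_injective_map topspace_subtopology_subset)

lemma continuous_chart: "continuous_map (subtopology N V) euclidean \<psi>"
  using homeomorphic_imp_continuous_map[OF homeo_chart]
  by (simp add: continuous_map_in_subtopology)

lemma continuous_chart_inv: "continuous_map (top_of_set (\<psi> ` V)) N (inv_into V \<psi>)"
proof -
  obtain g where g: "homeomorphic_maps (subtopology N V) (top_of_set (\<psi> ` V)) \<psi> g"
    using homeo_chart homeomorphic_map_maps by blast
  have top: "topspace (subtopology N V) = V"
    using openin_chart openin_subset by (metis topspace_subtopology_subset)
  have "continuous_map (top_of_set (\<psi> ` V)) (subtopology N V) g"
    using g by (simp add: homeomorphic_maps_def)
  moreover have "g y = inv_into V \<psi> y" if "y \<in> topspace (top_of_set (\<psi> ` V))" for y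
    using g that inj_chart unfolding homeomorphic_maps_def top by (auto simp: inv_into_f_f)
  ultimately have "continuous_map (top_of_set (\<psi> ` V)) (subtopology N V) (inv_into V \<psi>)"
    by (rule continuous_map_eq)
  then show ?thesis by (simp add: continuous_map_in_subtopology)
qed

lemma openin_chart_preimage:
  assumes "openin N \<Omega>" "open D" shows "openin N {z \<in> V \<inter> \<Omega>. \<psi> z \<in> D}"
proof -
  have "openin (subtopology N V) {z \<in> topspace (subtopology N V). \<psi> z \<in> D}"
    using assms by (intro openin_continuous_map_preimage[OF continuous_chart]) simp
  then have "openin N {z \<in> topspace (subtopology N V). \<psi> z \<in> D}"
    using openin_chart openin_trans_full by blast
  then have "openin N (\<Omega> \<inter> {z \<in> topspace (subtopology N V). \<psi> z \<in> D})"
    by (rule openin_Int[OF assms(1)])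
  moreover have "\<Omega> \<inter> {z \<in> topspace (subtopology N V). \<psi> z \<in> D} = {z \<in> V \<inter> \<Omega>. \<psi> z \<in> D}"
    using openin_subset[OF openin_chart] by auto
  ultimately show ?thesis by simp
qed

lemma open_image_chart:
  assumes "openin N \<Omega>" shows "open (\<psi> ` (V \<inter> \<Omega>))"
proof -
  have "openin (subtopology N V) (V \<inter> \<Omega>)" using assms by (auto simp: openin_subtopology)
  then have "openin (top_of_set (\<psi> ` V)) (\<psi> ` (V \<inter> \<Omega>))"
    using homeo_chart homeomorphic_imp_open_map open_map_def by metis
  then show ?thesis using open_chart_image openin_open_trans by blast
qed

end

section \<open>Transition maps, connectedness in leaves and transverse Lipschitz bounds\<close>

lemma chart_exists: "z \<in> topspace N \<Longrightarrow> \<exists>V \<psi>. (V, \<psi>) \<in> B \<and> z \<in> V"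
proof -
  have "(\<Union>(V, \<psi>)\<in>B. V) = topspace N" using fol unfolding C1_foliation_def by (elim conjE)
  then show "z \<in> topspace N \<Longrightarrow> \<exists>V \<psi>. (V, \<psi>) \<in> B \<and> z \<in> V" by blast
qed

lemma transition:
  assumes "(V, \<psi>) \<in> B" "(V', \<psi>') \<in> B"
  shows "C1_on (\<lambda>x. \<psi>' (inv_into V \<psi> x)) (\<psi> ` (V \<inter> V'))"
    and "z \<in> \<psi> ` (V \<inter> V') \<Longrightarrow> \<exists>O'. open O' \<and> z \<in> O' \<and> O' \<subseteq> \<psi> ` (V \<inter> V') \<and>
      (\<forall>x\<in>O'. \<forall>y\<in>O'. transverse J x = transverse J y \<longrightarrow>
        transverse J (\<psi>' (inv_into V \<psi> x)) = transverse J (\<psi>' (inv_into V \<psi> y)))"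
proof -
  let ?\<tau> = "\<lambda>x. \<psi>' (inv_into V \<psi> x)" and ?D = "\<psi> ` (V \<inter> V')"
  have "\<forall>(V, \<psi>)\<in>B. \<forall>(V', \<psi>')\<in>B.
        let \<tau> = (\<lambda>x. \<psi>' (inv_into V \<psi> x)); D = \<psi> ` (V \<inter> V') in
        C1_on \<tau> D \<and>
        (\<forall>z\<in>D. \<exists>O'. open O' \<and> z \<in> O' \<and> O' \<subseteq> D \<and>
           (\<forall>x\<in>O'. \<forall>y\<in>O'. same_transverse J x y \<longrightarrow> same_transverse J (\<tau> x) (\<tau> y)))"
    using fol unfolding C1_foliation_def by (elim conjE)
  from bspec[OF this assms(1), simplified, THEN bspec, OF assms(2)]
  have *: "C1_on ?\<tau> ?D" "\<forall>z\<in>?D. \<exists>O'. open O' \<and> z \<in> O' \<and> O' \<subseteq> ?D \<and>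
      (\<forall>x\<in>O'. \<forall>y\<in>O'. same_transverse J x y \<longrightarrow> same_transverse J (?\<tau> x) (?\<tau> y))"
    by (simp_all add: Let_def)
  show "C1_on ?\<tau> ?D" by (rule *(1))
  show "z \<in> ?D \<Longrightarrow> \<exists>O'. open O' \<and> z \<in> O' \<and> O' \<subseteq> ?D \<and>
      (\<forall>x\<in>O'. \<forall>y\<in>O'. transverse J x = transverse J y \<longrightarrow> transverse J (?\<tau> x) = transverse J (?\<tau> y))"
    using bspec[OF *(2), of z] unfolding same_transverse_iff .
qed

text \<open>The inverse chart is continuous from the Euclidean topology of a plaque to the leaf
  topology, so it carries connected sets to connected sets.\<close>

lemma connectedin_slice:
  assumes V: "(V, \<psi>) \<in> B" and S: "S \<subseteq> \<psi> ` V" "connected S"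
    and tr: "\<And>x y. x \<in> S \<Longrightarrow> y \<in> S \<Longrightarrow> transverse J x = transverse J y"
  shows "connectedin (mfd_leaf_topology J B) (inv_into V \<psi> ` S)"
proof -
  let ?g = "inv_into V \<psi>"
  have "continuous_map (top_of_set S) (mfd_leaf_topology J B) ?g"
    unfolding mfd_leaf_topology_def continuous_on_generated_topo_iff
  proof (intro conjI allI impI)
    fix U assume "U \<in> {{p \<in> V. \<psi> p \<in> O' \<and> same_transverse J (\<psi> p) a} | V \<psi> O' a. (V, \<psi>) \<in> B \<and> open O'}"
    then obtain V' \<psi>' O' a where U: "U = {p \<in> V'. \<psi>' p \<in> O' \<and> same_transverse J (\<psi>' p) a}"
      and V': "(V', \<psi>') \<in> B" and O': "open O'" by blast
    have "\<exists>T. openin (top_of_set S) T \<and> y \<in> T \<and> T \<subseteq> ?g -` U \<inter> S" if y: "y \<in> ?g -` U \<inter> S" for y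
    proof -
      let ?\<tau> = "\<lambda>x. \<psi>' (?g x)"
      have "?g y \<in> V'" using y U by auto
      moreover have "?g y \<in> V" "\<psi> (?g y) = y" using y S by (auto intro: inv_into_into f_inv_into_f)
      ultimately have "y \<in> \<psi> ` (V \<inter> V')" by (metis IntI image_eqI)
      \<comment> \<open>Transitions preserve plaques only locally. Since \<open>S\<close> lies in
        one plaque of \<open>V\<close>, its part in \<open>Q\<close> is sent into one plaque of
        \<open>V'\<close>, the one through the image of \<open>y\<close>. The plaque condition in
        \<open>U\<close> then holds on it, and only the open condition \<open>O'\<close>
        remains.\<close>
      then obtain Q where Q: "open Q" "y \<in> Q" "Q \<subseteq> \<psi> ` (V \<inter> V')"
        "\<And>u v. u \<in> Q \<Longrightarrow> v \<in> Q \<Longrightarrow> transverse J u = transverse J v \<Longrightarrow>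
           transverse J (?\<tau> u) = transverse J (?\<tau> v)"
        using transition(2)[OF V V'] by meson
      have "continuous_on (\<psi> ` (V \<inter> V')) ?\<tau>"
        using transition(1)[OF V V'] unfolding C1_on_def
        by (meson continuous_at_imp_continuous_on has_derivative_continuous)
      then have "continuous_on Q ?\<tau>" using Q(3) by (rule continuous_on_subset)
      then have op: "open (?\<tau> -` O' \<inter> Q)" using Q(1) O' by (simp add: continuous_on_open_vimage)
      have "S \<inter> (?\<tau> -` O' \<inter> Q) \<subseteq> ?g -` U \<inter> S"
      proof
        fix x assume x: "x \<in> S \<inter> (?\<tau> -` O' \<inter> Q)"
        then obtain v where "x = \<psi> v" "v \<in> V \<inter> V'" using Q(3) by blast
        then have "?g x \<in> V'" using inj_chart[OF V] by (simp add: inv_into_f_f)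
        moreover have "transverse J (?\<tau> x) = transverse J (?\<tau> y)"
          using x y Q tr by (intro Q(4)) auto
        ultimately show "x \<in> ?g -` U \<inter> S" using x y by (auto simp: U same_transverse_iff)
      qed
      then show ?thesis using op y Q U by (intro exI[of _ "S \<inter> (?\<tau> -` O' \<inter> Q)"]) auto
    qed
    then show "openin (top_of_set S) (?g -` U \<inter> topspace (top_of_set S))"
      by (subst openin_subopen) auto
  next
    show "?g ` topspace (top_of_set S) \<subseteq>
      \<Union>{{p \<in> V. \<psi> p \<in> O' \<and> same_transverse J (\<psi> p) a} | V \<psi> O' a. (V, \<psi>) \<in> B \<and> open O'}"
    proof (rule image_subsetI)
      fix x assume "x \<in> topspace (top_of_set S)"
      then have "?g x \<in> V" using S by (auto intro: inv_into_into)
      then have mem: "?g x \<in> {p \<in> V. \<psi> p \<in> UNIV \<and> same_transverse J (\<psi> p) (\<psi> (?g x))}" (is "_ \<in> ?U")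
        by (simp add: same_transverse_def)
      have "\<exists>V \<psi> O' a. ?U = {p \<in> V. \<psi> p \<in> O' \<and> same_transverse J (\<psi> p) a} \<and> (V, \<psi>) \<in> B \<and> open O'"
        by (rule exI[of _ V], rule exI[of _ \<psi>], rule exI[of _ UNIV], rule exI[of _ "\<psi> (?g x)"])
          (use V in simp)
      then show "?g x \<in> \<Union>{{p \<in> V. \<psi> p \<in> O' \<and> same_transverse J (\<psi> p) a} | V \<psi> O' a. (V, \<psi>) \<in> B \<and> open O'}"
        by (rule UnionI[OF CollectI mem])
    qed
  qed
  then show ?thesis using S(2) connectedin_continuous_map_image[of "top_of_set S" _ ?g S] by simp
qed

text \<open>A leaf is a component, so it absorbs every connected set that meets it.\<close>

lemma slice_subset_invariant:
  assumes V: "(V, \<psi>) \<in> B" and S: "S \<subseteq> \<psi> ` V" "connected S"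
    and tr: "\<And>x y. x \<in> S \<Longrightarrow> y \<in> S \<Longrightarrow> transverse J x = transverse J y"
    and Z: "invariant_set J B Z" and x: "x \<in> S" "inv_into V \<psi> x \<in> Z"
  shows "inv_into V \<psi> ` S \<subseteq> Z"
proof -
  obtain \<L> where \<L>: "\<L> \<subseteq> connected_components_of (mfd_leaf_topology J B)" "Z = \<Union>\<L>"
    using Z unfolding invariant_set_def mfd_leaves_def by blast
  then obtain C where C: "C \<in> \<L>" "inv_into V \<psi> x \<in> C" using x by blast
  have "inv_into V \<psi> ` S \<subseteq> C"
    by (rule connected_components_of_maximal[OF _ connectedin_slice[OF V S tr]])
      (use C \<L> x in \<open>auto simp: disjnt_iff\<close>)
  then show ?thesis using C \<L> by blast
qed

text \<open>The mean value inequality would bound the left side by the full displacement. Moving one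
  point along its plaque first does not change its new transverse coordinate, and leaves only the
  transverse displacement.\<close>

lemma transition_Lipschitz:
  assumes V: "(V, \<psi>) \<in> B" and V': "(V', \<psi>') \<in> B" and z: "z \<in> V" "z \<in> V'"
  obtains \<Omega> L where "openin N \<Omega>" "z \<in> \<Omega>" "\<Omega> \<subseteq> V \<inter> V'"
    "\<And>p q. p \<in> \<Omega> \<Longrightarrow> q \<in> \<Omega> \<Longrightarrow>
      norm (transverse J (\<psi>' p) - transverse J (\<psi>' q)) \<le> L * norm (transverse J (\<psi> p) - transverse J (\<psi> q))"
proof -
  let ?\<tau> = "\<lambda>x. \<psi>' (inv_into V \<psi> x)"
  have zz: "\<psi> z \<in> \<psi> ` (V \<inter> V')" using z by auto
  obtain Q where Q: "open Q" "\<psi> z \<in> Q" "Q \<subseteq> \<psi> ` (V \<inter> V')"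
      "\<And>u v. u \<in> Q \<Longrightarrow> v \<in> Q \<Longrightarrow> transverse J u = transverse J v \<Longrightarrow>
         transverse J (?\<tau> u) = transverse J (?\<tau> v)"
    using transition(2)[OF V V' zz] by meson
  obtain f' where f': "\<And>x. x \<in> \<psi> ` (V \<inter> V') \<Longrightarrow> (?\<tau> has_derivative blinfun_apply (f' x)) (at x)"
    "continuous_on (\<psi> ` (V \<inter> V')) f'"
    using transition(1)[OF V V'] unfolding C1_on_def by blast
  \<comment> \<open>The summand 1 leaves room for the continuous derivative to stay below
    \<open>L\<close> on a whole neighbourhood.\<close>
  define L where "L = norm (f' (\<psi> z)) + 1"
  have "continuous_on Q (\<lambda>x. norm (f' x))"
    by (rule continuous_on_norm[OF continuous_on_subset[OF f'(2) Q(3)]])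
  then have "open ((\<lambda>x. norm (f' x)) -` {..<L} \<inter> Q)"
    using Q(1) by (simp add: continuous_on_open_vimage)
  moreover have "\<psi> z \<in> (\<lambda>x. norm (f' x)) -` {..<L} \<inter> Q" using Q by (simp add: L_def)
  ultimately obtain r where r: "r > 0" "cube_at (\<psi> z) r \<subseteq> (\<lambda>x. norm (f' x)) -` {..<L} \<inter> Q"
    by (rule cube_at_subset)
  let ?D = "cube_at (\<psi> z) r"
  have lip: "norm (?\<tau> x - ?\<tau> y) \<le> L * norm (x - y)" if "x \<in> ?D" "y \<in> ?D" for x y
  proof (rule differentiable_bound[OF convex_cube_at])
    fix x assume x: "x \<in> ?D"
    then show "(?\<tau> has_derivative blinfun_apply (f' x)) (at x within ?D)"
      using f'(1)[of x] r Q by (blast intro: has_derivative_at_withinI)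
    show "onorm (blinfun_apply (f' x)) \<le> L"
      using r(2) x by (auto simp flip: norm_blinfun.rep_eq)
  qed (use that in auto)
  define \<Omega> where "\<Omega> = {q \<in> V \<inter> V'. \<psi> q \<in> ?D}"
  show ?thesis
  proof (rule that[of \<Omega> L])
    show "openin N \<Omega>" unfolding \<Omega>_def
      by (rule openin_chart_preimage[OF V openin_chart[OF V'] open_cube_at])
    show "z \<in> \<Omega>" using z r by (simp add: \<Omega>_def cube_at_def)
    show "\<Omega> \<subseteq> V \<inter> V'" by (auto simp: \<Omega>_def)
    fix p q assume pq: "p \<in> \<Omega>" "q \<in> \<Omega>"
    have \<tau>: "\<psi>' p = ?\<tau> (\<psi> p)" "\<psi>' q = ?\<tau> (\<psi> q)"
      using pq inj_chart[OF V] by (auto simp: \<Omega>_def inv_into_f_f)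
    \<comment> \<open>lies on the plaque of \<open>q\<close>, and differs from \<open>\<psi> p\<close> only transversally\<close>
    define y where "y = (\<chi> i. if i \<in> J then \<psi> p $ i else \<psi> q $ i)"
    have pD: "\<psi> p \<in> ?D" and qD: "\<psi> q \<in> ?D" using pq by (auto simp: \<Omega>_def)
    then have yD: "y \<in> ?D" by (auto simp: cube_at_def y_def)
    have "transverse J y = transverse J (\<psi> q)" by (simp add: transverse_def y_def vec_eq_iff)
    then have "transverse J (?\<tau> (\<psi> q)) = transverse J (?\<tau> y)"
      using yD qD r Q(4)[of "\<psi> q" y] by auto
    then have "norm (transverse J (\<psi>' p) - transverse J (\<psi>' q)) = norm (transverse J (?\<tau> (\<psi> p) - ?\<tau> y))"
      by (simp add: \<tau> flip: transverse_diff)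
    also have "\<dots> \<le> norm (?\<tau> (\<psi> p) - ?\<tau> y)" by (rule norm_transverse_le)
    also have "\<dots> \<le> L * norm (\<psi> p - y)" by (rule lip[OF pD yD])
    also have "\<psi> p - y = transverse J (\<psi> p) - transverse J (\<psi> q)"
      by (simp add: y_def transverse_def vec_eq_iff)
    finally show "norm (transverse J (\<psi>' p) - transverse J (\<psi>' q))
      \<le> L * norm (transverse J (\<psi> p) - transverse J (\<psi> q))" .
  qed
qed

end

section \<open>Charts of the embedded foliated space\<close>

text \<open>Openness of the transversal makes it equal to its own interior, so the chart maps the
  open set \<open>U\<close> exactly onto \<open>open_cube 1 \<times> T\<close>.\<close>

locale clopen_chart =
  fixes M :: "'a topology" and X :: "'x topology" and A :: "('a, 'n::finite, 'x) fol_chart set"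
    and c :: "('a, 'n, 'x) fol_chart"
  assumes chart: "foliated_chart M X A c" and open_trans: "openin X (chart_trans c)"
begin

abbreviation "U \<equiv> chart_dom c"
abbreviation "T \<equiv> chart_trans c"
abbreviation "E \<equiv> prod_topology (euclidean :: (real ^ 'n) topology) X"

lemma openin_dom: "openin M U"
  and chart_homeo: "homeomorphic_map (subtopology M (M closure_of U)) (subtopology E (closed_cube 1 \<times> T)) (chart_map c)"
  and chart_image: "chart_map c ` U = open_cube 1 \<times> T"
  and compact_trans: "compactin X T"
  using chart unfolding foliated_chart_def Let_def interior_of_openin[OF open_trans]
  by simp_all

lemma dom_subset_closure: "U \<subseteq> M closure_of U"
  using openin_dom by (simp add: closure_of_subset openin_subset)

lemma inj_chart_map: "inj_on (chart_map c) (M closure_of U)"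
  using homeomorphic_imp_injective_map[OF chart_homeo]
  by (simp add: Int_absorb1 closure_of_subset_topspace)

lemma chart_inv_coords:
  assumes "p \<in> U" shows "chart_inv M c (leaf_coord c p, trans_coord c p) = p"
  unfolding chart_inv_def leaf_coord_def trans_coord_def
  using assms dom_subset_closure inj_chart_map by (auto simp: inv_into_f_f)

lemma coords_mem: "p \<in> U \<Longrightarrow> leaf_coord c p \<in> open_cube 1" "p \<in> U \<Longrightarrow> trans_coord c p \<in> T"
proof -
  have "chart_map c p \<in> open_cube 1 \<times> T" if "p \<in> U" for p
    using that chart_image by blast
  then show "p \<in> U \<Longrightarrow> leaf_coord c p \<in> open_cube 1" "p \<in> U \<Longrightarrow> trans_coord c p \<in> T"
    unfolding leaf_coord_def trans_coord_def by (simp_all add: mem_Times_iff)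
qed

lemma chart_inv_mem:
  assumes "y \<in> open_cube 1" "w \<in> T"
  shows "chart_inv M c (y, w) \<in> U" "leaf_coord c (chart_inv M c (y, w)) = y"
    "trans_coord c (chart_inv M c (y, w)) = w"
proof -
  obtain p where p: "p \<in> U" "chart_map c p = (y, w)"
  proof -
    have "(y, w) \<in> chart_map c ` U" using assms by (simp add: chart_image)
    then show thesis using that by (elim imageE) simp
  qed
  have "chart_inv M c (y, w) = p"
    using chart_inv_coords[OF p(1)] p(2) by (simp add: leaf_coord_def trans_coord_def)
  then show "chart_inv M c (y, w) \<in> U" "leaf_coord c (chart_inv M c (y, w)) = y"
    "trans_coord c (chart_inv M c (y, w)) = w"
    using p by (simp_all add: leaf_coord_def trans_coord_def)
qed

lemma continuous_map_chart: "continuous_map (subtopology M U) E (chart_map c)"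
proof -
  have "continuous_map (subtopology M (M closure_of U)) E (chart_map c)"
    using homeomorphic_imp_continuous_map[OF chart_homeo] by (simp add: continuous_map_in_subtopology)
  then show ?thesis using dom_subset_closure by (rule continuous_map_from_subtopology_mono)
qed

lemma continuous_map_leaf_coord: "continuous_map (subtopology M U) euclidean (leaf_coord c)"
  and continuous_map_trans_coord: "continuous_map (subtopology M U) X (trans_coord c)"
  using continuous_map_compose[OF continuous_map_chart continuous_map_fst]
    continuous_map_compose[OF continuous_map_chart continuous_map_snd]
  by (simp_all add: leaf_coord_def[abs_def] trans_coord_def[abs_def] comp_def)

lemma continuous_map_chart_inv:
  "continuous_map (subtopology E (open_cube 1 \<times> T)) M (chart_inv M c)"
proof -
  let ?C = "M closure_of U"
  have top: "topspace (subtopology M ?C) = ?C"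
    by (simp add: Int_absorb1 closure_of_subset_topspace)
  obtain g where g: "homeomorphic_maps (subtopology M ?C) (subtopology E (closed_cube 1 \<times> T)) (chart_map c) g"
    using chart_homeo homeomorphic_map_maps by blast
  then have "continuous_map (subtopology E (closed_cube 1 \<times> T)) M g"
    by (simp add: homeomorphic_maps_def continuous_map_in_subtopology)
  moreover have "open_cube 1 \<times> T \<subseteq> closed_cube 1 \<times> T"
    by (auto simp: open_cube_def closed_cube_def less_imp_le)
  ultimately have "continuous_map (subtopology E (open_cube 1 \<times> T)) M g"
    by (rule continuous_map_from_subtopology_mono)
  moreover have "g yw = chart_inv M c yw" if "yw \<in> topspace (subtopology E (open_cube 1 \<times> T))" for yw
  proof -
    have "yw \<in> chart_map c ` U" using that by (simp add: chart_image)
    then obtain p where p: "p \<in> U" "chart_map c p = yw" by blast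
    then have "p \<in> ?C" using dom_subset_closure by blast
    then have "g (chart_map c p) = p" using g top unfolding homeomorphic_maps_def by simp
    then show ?thesis using chart_inv_coords[OF p(1)] p by (simp add: leaf_coord_def trans_coord_def)
  qed
  ultimately show ?thesis by (rule continuous_map_eq)
qed

lemma chart_inv_neighbourhood:
  assumes "y0 \<in> open_cube 1" "w0 \<in> T" "openin M Q" "chart_inv M c (y0, w0) \<in> Q"
  obtains r W where "r > 0" "openin X W" "w0 \<in> W" "W \<subseteq> T" "ball y0 r \<subseteq> open_cube 1"
    "\<forall>y\<in>ball y0 r. \<forall>u\<in>W. chart_inv M c (y, u) \<in> Q"
proof -
  have op: "open (open_cube 1 :: (real ^ 'n) set)"
    using open_cube_at[of 0 1] by (simp add: cube_at_def open_cube_def)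
  have TX: "T \<subseteq> topspace X" using open_trans by (rule openin_subset)
  let ?S = "subtopology E (open_cube 1 \<times> T)"
  have top: "topspace ?S = open_cube 1 \<times> T" using TX by auto
  have "openin ?S {q \<in> topspace ?S. chart_inv M c q \<in> Q}"
    by (rule openin_continuous_map_preimage[OF continuous_map_chart_inv assms(3)])
  moreover have "openin E (open_cube 1 \<times> T)" using op open_trans by (simp add: openin_prod_Times_iff)
  ultimately have "openin E {q \<in> open_cube 1 \<times> T. chart_inv M c q \<in> Q}"
    unfolding top by (rule openin_trans_full)
  moreover have "(y0, w0) \<in> {q \<in> open_cube 1 \<times> T. chart_inv M c q \<in> Q}" using assms by auto
  ultimately have "\<exists>R W. openin euclidean R \<and> openin X W \<and> y0 \<in> R \<and> w0 \<in> W \<and>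
    R \<times> W \<subseteq> {q \<in> open_cube 1 \<times> T. chart_inv M c q \<in> Q}"
    by (rule openin_prod_topology_alt[THEN iffD1, rule_format])
  then obtain R W where RW: "open R" "openin X W" "y0 \<in> R" "w0 \<in> W"
    "R \<times> W \<subseteq> {q \<in> open_cube 1 \<times> T. chart_inv M c q \<in> Q}"
    by (elim exE conjE) simp
  have mem: "y \<in> open_cube 1" "u \<in> T" "chart_inv M c (y, u) \<in> Q" if "y \<in> R" "u \<in> W" for y u
    using subsetD[OF RW(5), of "(y, u)"] that by simp_all
  obtain r where r: "r > 0" "ball y0 r \<subseteq> R" using RW(1,3) by (rule openE)
  show ?thesis
  proof (rule that[OF r(1) RW(2,4)])
    show "W \<subseteq> T" using mem(2)[OF RW(3)] by blast
    show "ball y0 r \<subseteq> open_cube 1" using mem(1)[OF _ RW(4)] r(2) by blast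
    show "\<forall>y\<in>ball y0 r. \<forall>u\<in>W. chart_inv M c (y, u) \<in> Q" using mem(3) r(2) by blast
  qed
qed

end

lemma open_open_cube: "open (open_cube r :: (real ^ 'n::finite) set)"
  and convex_open_cube: "convex (open_cube r :: (real ^ 'n::finite) set)"
  using open_cube_at[of 0 r] convex_cube_at[of 0 r] by (simp_all add: cube_at_def open_cube_def)

text \<open>The kernel consists of the plaque directions; invariance of domain compares its
  dimension with \<open>CARD('n)\<close>.\<close>

lemma dim_transverse_kernel:
  fixes J :: "'m::finite set"
  shows "dim {x. transverse J x = 0} = card J"
proof -
  let ?d = "(\<lambda>i. axis i 1 :: real ^ 'm) ` J"
  have Basis: "(Basis :: (real ^ 'm) set) = range (\<lambda>i. axis i 1)"
    by (auto simp: Basis_vec_def)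
  have mem: "axis i 1 \<in> ?d \<longleftrightarrow> i \<in> J" for i
    by (simp add: image_iff axis_eq_axis)
  have "(transverse J x = 0) = (\<forall>i\<in>Basis. i \<notin> ?d \<longrightarrow> x \<bullet> i = 0)" for x
    unfolding Basis ball_simps mem by (simp add: transverse_def vec_eq_iff inner_axis)
  moreover have "card ?d = card J"
    by (intro card_image inj_onI) (simp add: axis_eq_axis)
  moreover have "?d \<subseteq> Basis" unfolding Basis by blast
  ultimately show ?thesis using dim_substandard[of ?d] by (simp only:)
qed

lemma subspace_transverse_kernel: "subspace {x. transverse J x = 0}"
proof -
  have "transverse J x = 0 \<longleftrightarrow> (\<forall>i. i \<notin> J \<longrightarrow> x $ i = 0)" for x
    by (simp add: transverse_def vec_eq_iff)
  then show ?thesis by (simp add: subspace_def)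
qed

section \<open>Box plaques of the manifold against plaques of the embedded space\<close>

locale embedded_foliated_space = foliated_manifold N J B
  for N :: "'b topology" and J :: "'m::finite set" and B :: "('b, 'm) mfd_chart set" +
  fixes M :: "'a topology" and X :: "'x topology" and Z :: "'b set" and f :: "'a \<Rightarrow> 'b"
  assumes inv_Z: "invariant_set J B Z"
    and homeo: "homeomorphic_map M (subtopology N Z) f"
    and tot_disc: "totally_disconnected_space X"
begin

lemma f_mem: "p \<in> topspace M \<Longrightarrow> f p \<in> Z \<and> f p \<in> topspace N"
  using imageI[of p "topspace M" f] unfolding homeomorphic_imp_surjective_map[OF homeo] by simp

lemma continuous_map_f: "continuous_map M N f"
  using homeomorphic_imp_continuous_map[OF homeo] by (simp add: continuous_map_in_subtopology)

lemma inj_f: "inj_on f (topspace M)"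
  using homeo by (rule homeomorphic_imp_injective_map)

lemma continuous_map_inv_f:
  "continuous_map (subtopology N Z) M (inv_into (topspace M) f)"
proof -
  obtain g where g: "homeomorphic_maps M (subtopology N Z) f g"
    using homeo homeomorphic_map_maps by blast
  then have "continuous_map (subtopology N Z) M g" by (simp add: homeomorphic_maps_def)
  moreover have "g z = inv_into (topspace M) f z" if z: "z \<in> topspace (subtopology N Z)" for z
  proof -
    have "z \<in> f ` topspace M" using homeomorphic_imp_surjective_map[OF homeo] z by simp
    then obtain p where "p \<in> topspace M" "z = f p" by blast
    then show ?thesis using g inj_f by (simp add: homeomorphic_maps_def inv_into_f_f)
  qed
  ultimately show ?thesis by (rule continuous_map_eq)
qed

text \<open>Invariance puts the whole slice into \<open>Z\<close>, and \<open>\<Omega>\<close> keeps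
  it inside the image of the chart domain. The transverse coordinate of \<open>M\<close> then maps a
  connected set into a totally disconnected space, hence is constant.\<close>

lemma slice_pullback:
  assumes c: "clopen_chart M X A c"
    and V: "(V, \<psi>) \<in> B" and \<Omega>: "f ` chart_dom c = topspace N \<inter> Z \<inter> \<Omega>"
    and S: "S \<subseteq> \<psi> ` (V \<inter> \<Omega>)" "connected S"
    and tr: "\<And>x y. x \<in> S \<Longrightarrow> y \<in> S \<Longrightarrow> transverse J x = transverse J y"
    and p: "p \<in> topspace M" "f p \<in> V" "\<psi> (f p) \<in> S"
  defines "h \<equiv> \<lambda>x. inv_into (topspace M) f (inv_into V \<psi> x)"
  shows "continuous_map (top_of_set S) (subtopology M (chart_dom c)) h"
    and "h (\<psi> (f p)) = p"
    and "\<And>x. x \<in> S \<Longrightarrow> h x \<in> chart_dom c \<and> f (h x) = inv_into V \<psi> x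
        \<and> trans_coord c (h x) = trans_coord c p"
proof -
  interpret clopen_chart M X A c by (rule c)
  have inj: "inj_on \<psi> V" by (rule inj_chart[OF V])
  have SV: "S \<subseteq> \<psi> ` V" using S by blast
  have "inv_into V \<psi> ` S \<subseteq> Z"
    by (rule slice_subset_invariant[OF V SV S(2) tr inv_Z p(3)])
      (use p inj f_mem in \<open>auto simp: inv_into_f_f\<close>)
  moreover have "inv_into V \<psi> x \<in> V \<inter> \<Omega>" if "x \<in> S" for x
    using S that inj by (auto simp: inv_into_f_f)
  moreover have "V \<subseteq> topspace N" using openin_chart[OF V] by (rule openin_subset)
  ultimately have mem: "inv_into V \<psi> x \<in> f ` U" "inv_into V \<psi> x \<in> topspace (subtopology N Z)" if "x \<in> S" for x
    using that \<Omega> by auto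
  have UM: "U \<subseteq> topspace M" using openin_dom by (rule openin_subset)
  have hx: "h x \<in> U \<and> f (h x) = inv_into V \<psi> x" if x: "x \<in> S" for x
  proof -
    obtain q where "q \<in> U" "inv_into V \<psi> x = f q" using mem(1)[OF x] by blast
    then show ?thesis using UM inj_f by (auto simp: h_def inv_into_f_f subset_iff)
  qed
  show hp: "h (\<psi> (f p)) = p" using p inj inj_f by (simp add: h_def inv_into_f_f)
  have "continuous_map (top_of_set S) (subtopology N Z) (inv_into V \<psi>)"
    using continuous_map_from_subtopology_mono[OF continuous_chart_inv[OF V] SV] mem
    by (auto simp: continuous_map_in_subtopology)
  from continuous_map_compose[OF this continuous_map_inv_f]
  have "continuous_map (top_of_set S) M h" by (simp add: h_def comp_def)
  then show cont: "continuous_map (top_of_set S) (subtopology M U) h"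
    using hx by (auto simp: continuous_map_in_subtopology)
  from continuous_map_compose[OF this continuous_map_trans_coord]
  have "connectedin X ((trans_coord c \<circ> h) ` S)"
    by (rule connectedin_continuous_map_image) (simp add: connectedin_subtopology S(2))
  then obtain w where "(trans_coord c \<circ> h) ` S \<subseteq> {w}"
    using tot_disc unfolding totally_disconnected_space_def by blast
  then have "trans_coord c (h x) = trans_coord c (h (\<psi> (f p)))" if "x \<in> S" for x
    using that p by auto
  then show "\<And>x. x \<in> S \<Longrightarrow> h x \<in> U \<and> f (h x) = inv_into V \<psi> x \<and> trans_coord c (h x) = trans_coord c p"
    using hx hp by simp
qed

text \<open>
  If the transverse coordinate took two values on a plaque of \<open>M\<close>, it would take uncountably many
  by connectedness.  The corresponding plaques of the box would be mapped into the same plaque of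
  \<open>M\<close>, onto pairwise disjoint sets that are open by invariance of domain.
\<close>

lemma transverse_constant:
  fixes c :: "('a, 'n::finite, 'x) fol_chart"
  assumes c: "clopen_chart M X A c" and J: "card J = CARD('n)"
    and y0: "y0 \<in> open_cube 1" and w0: "w0 \<in> chart_trans c"
    and V: "(V, \<psi>) \<in> B" "f (chart_inv M c (y0, w0)) \<in> V"
  obtains r W where "r > 0" "openin X W" "w0 \<in> W" "W \<subseteq> chart_trans c" "ball y0 r \<subseteq> open_cube 1"
    "\<forall>y\<in>ball y0 r. \<forall>u\<in>W. f (chart_inv M c (y, u)) \<in> V \<and>
      transverse J (\<psi> (f (chart_inv M c (y, u)))) = transverse J (\<psi> (f (chart_inv M c (y0, u))))"
    "inj_on (\<lambda>u. transverse J (\<psi> (f (chart_inv M c (y0, u))))) W"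
proof -
  interpret clopen_chart M X A c by (rule c)
  let ?p = "\<lambda>y u. chart_inv M c (y, u)"
  have UM: "U \<subseteq> topspace M" using openin_dom by (rule openin_subset)
  have inj: "inj_on \<psi> V" by (rule inj_chart[OF V(1)])
  have "openin (subtopology N Z) (f ` U)"
    using homeomorphic_imp_open_map[OF homeo] openin_dom by (simp add: open_map_def)
  \<comment> \<open>Without \<open>\<Omega>\<close> a box plaque could leave the image of
    \<open>U\<close> while staying in \<open>Z\<close>.\<close>
  then obtain \<Omega> where \<Omega>: "openin N \<Omega>" "f ` U = \<Omega> \<inter> Z" by (auto simp: openin_subtopology)
  have \<Omega>': "f ` U = topspace N \<inter> Z \<inter> \<Omega>" using \<Omega> openin_subset by blast
  have z0: "f (?p y0 w0) \<in> V \<inter> \<Omega>" using V chart_inv_mem[OF y0 w0] \<Omega> by auto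
  obtain \<rho> where \<rho>: "\<rho> > 0" "cube_at (\<psi> (f (?p y0 w0))) \<rho> \<subseteq> \<psi> ` (V \<inter> \<Omega>)"
    by (rule cube_at_subset[OF open_image_chart[OF V(1) \<Omega>(1)]]) (use z0 in auto)
  define D where "D = cube_at (\<psi> (f (?p y0 w0))) \<rho>"
  have D: "open D" "convex D" "D \<subseteq> \<psi> ` (V \<inter> \<Omega>)" "\<psi> (f (?p y0 w0)) \<in> D"
    using \<rho> open_cube_at convex_cube_at by (auto simp: D_def) (simp_all add: cube_at_def)
  define Q where "Q = {p \<in> topspace M. f p \<in> {z \<in> V \<inter> \<Omega>. \<psi> z \<in> D}}"
  have Qo: "openin M Q" unfolding Q_def
    by (rule openin_continuous_map_preimage[OF continuous_map_f openin_chart_preimage[OF V(1) \<Omega>(1) D(1)]])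
  have Qm: "?p y0 w0 \<in> Q"
    using z0 D chart_inv_mem[OF y0 w0] UM by (auto simp: Q_def)
  obtain r W where rW: "r > 0" "openin X W" "w0 \<in> W" "W \<subseteq> T" "ball y0 r \<subseteq> open_cube 1"
    "\<forall>y\<in>ball y0 r. \<forall>u\<in>W. ?p y u \<in> Q"
    by (rule chart_inv_neighbourhood[OF y0 w0 Qo Qm])
  define slice where "slice t = {x \<in> D. transverse J x = t}" for t
  have slice_eq: "slice t = D \<inter> {x. transverse J x = t}" for t by (auto simp: slice_def)
  have conn: "connected (slice t)" for t
  proof -
    have "convex {x. transverse J x = t}"
      unfolding convex_def by (auto simp: transverse_def vec_eq_iff simp flip: distrib_right)
    then show ?thesis unfolding slice_eq using D(2) by (intro convex_connected convex_Int)
  qed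
  define h where "h x = inv_into (topspace M) f (inv_into V \<psi> x)" for x
  define t where "t y u = transverse J (\<psi> (f (?p y u)))" for y u
  have pull: "continuous_map (top_of_set (slice (t y u))) (subtopology M U) h"
    "h (\<psi> (f (?p y u))) = ?p y u" "\<psi> (f (?p y u)) \<in> slice (t y u)"
    "\<And>x. x \<in> slice (t y u) \<Longrightarrow> h x \<in> U \<and> f (h x) = inv_into V \<psi> x \<and> trans_coord c (h x) = u"
    if yu: "y \<in> ball y0 r" "u \<in> W" for y u
  proof -
    have "?p y u \<in> Q" using rW(6) yu by blast
    then have p: "?p y u \<in> topspace M" "f (?p y u) \<in> V" "\<psi> (f (?p y u)) \<in> slice (t y u)"
      by (auto simp: Q_def slice_def t_def)
    have S: "slice (t y u) \<subseteq> \<psi> ` (V \<inter> \<Omega>)" using D(3) by (auto simp: slice_def)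
    have tr: "transverse J x = transverse J x'" if "x \<in> slice (t y u)" "x' \<in> slice (t y u)" for x x'
      using that by (simp add: slice_def)
    have u: "trans_coord c (?p y u) = u" using chart_inv_mem(3) yu rW(4,5) by blast
    note * = slice_pullback[OF c V(1) \<Omega>' S conn tr p, folded h_def]
    show "continuous_map (top_of_set (slice (t y u))) (subtopology M U) h" by (rule *(1))
    show "h (\<psi> (f (?p y u))) = ?p y u" by (rule *(2))
    show "\<psi> (f (?p y u)) \<in> slice (t y u)" by (rule p(3))
    show "\<And>x. x \<in> slice (t y u) \<Longrightarrow> h x \<in> U \<and> f (h x) = inv_into V \<psi> x \<and> trans_coord c (h x) = u"
      using *(3) u by simp
  qed
  \<comment> \<open>All slices in question lie over the same \<open>u\<close>, so the leaf
    coordinate alone determines the point. This yields both the injectivity on one slice and the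
    disjointness of the images of different slices.\<close>
  have h_inj: "x = x'" if "y \<in> ball y0 r" "y' \<in> ball y0 r" "u \<in> W" "x \<in> slice (t y u)" "x' \<in> slice (t y' u)"
    "leaf_coord c (h x) = leaf_coord c (h x')" for x x' y y' u
  proof -
    note a = pull(4)[OF that(1,3,4)] and b = pull(4)[OF that(2,3,5)]
    have "h x = h x'"
      using a b that(6) chart_inv_coords[of "h x"] chart_inv_coords[of "h x'"] by simp
    then have "inv_into V \<psi> x = inv_into V \<psi> x'" using a b by simp
    moreover have "x \<in> \<psi> ` V" "x' \<in> \<psi> ` V" using that(4,5) D(3) by (auto simp: slice_def)
    ultimately show ?thesis by (metis f_inv_into_f)
  qed
  have y0r: "y0 \<in> ball y0 r" using rW by simp
  have const: "t y u = t y0 u" if y: "y \<in> ball y0 r" and u: "u \<in> W" for y u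
  proof (rule ccontr)
    assume ne: "t y u \<noteq> t y0 u"
    let ?C = "(\<lambda>y. t y u) ` ball y0 r"
    have "continuous_on (ball y0 r) (\<lambda>y. t y u)"
    proof -
      have uT: "u \<in> T" using u rW by blast
      then have uX: "u \<in> topspace X" using open_trans openin_subset by blast
      have "continuous_map (top_of_set (ball y0 r)) (subtopology E (open_cube 1 \<times> T)) (\<lambda>y. (y, u))"
        using rW(5) uT uX by (auto simp: continuous_map_in_subtopology continuous_map_paired)
      from continuous_map_compose[OF continuous_map_compose[OF this continuous_map_chart_inv] continuous_map_f]
      have "continuous_map (top_of_set (ball y0 r)) N (\<lambda>y. f (?p y u))" by (simp add: comp_def)
      then have "continuous_map (top_of_set (ball y0 r)) (subtopology N V) (\<lambda>y. f (?p y u))"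
        using rW(6) u by (auto simp: continuous_map_in_subtopology Q_def)
      from continuous_map_compose[OF this continuous_chart[OF V(1)]]
      have "continuous_on (ball y0 r) (\<lambda>y. \<psi> (f (?p y u)))" by (simp add: comp_def)
      from continuous_on_compose[OF this continuous_on_transverse]
      show ?thesis by (simp add: comp_def t_def)
    qed
    then have "connected ?C" by (intro connected_continuous_image) auto
    then have unc: "uncountable ?C"
      by (rule connected_uncountable[of _ "t y u" "t y0 u"]) (use y y0r ne in auto)
    define O' where "O' s = (\<lambda>x. leaf_coord c (h x)) ` slice s" for s
    have O'_open: "open (O' (t y u))" if y: "y \<in> ball y0 r" for y
    proof -
      \<comment> \<open>Invariance of domain is applied between linear subspaces; the slice lies in
        an affine one and is translated by its point \<open>?a\<close> into the kernel.\<close>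
      let ?a = "\<psi> (f (?p y u))" and ?H = "{x. transverse J x = 0}"
      let ?S = "{v \<in> ?H. ?a + v \<in> D}"
      have ta: "transverse J ?a = t y u" by (simp add: t_def)
      have S_iff: "v \<in> ?S \<longleftrightarrow> ?a + v \<in> slice (t y u)" for v
        using transverse_diff[of J "?a + v" ?a] by (auto simp: slice_def ta)
      have O'_eq: "O' (t y u) = (\<lambda>v. leaf_coord c (h (?a + v))) ` ?S"
      proof -
        have "slice (t y u) = (\<lambda>v. ?a + v) ` ?S"
        proof (intro equalityI subsetI)
          fix x assume "x \<in> slice (t y u)"
          then have "x - ?a \<in> ?S" unfolding S_iff by simp
          then show "x \<in> (\<lambda>v. ?a + v) ` ?S" by (intro image_eqI[of _ _ "x - ?a"]) auto
        qed (use S_iff in blast)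
        then show ?thesis by (simp add: O'_def image_image)
      qed
      have cont: "continuous_on (slice (t y u)) (\<lambda>x. leaf_coord c (h x))"
        using continuous_map_compose[OF pull(1)[OF y u] continuous_map_leaf_coord] by (simp add: comp_def)
      have "openin (top_of_set UNIV) ((\<lambda>v. leaf_coord c (h (?a + v))) ` ?S)"
      proof (rule invariance_of_domain_subspaces)
        have op: "open ((\<lambda>v. ?a + v) -` D)" using D(1) by (intro open_vimage continuous_intros)
        have S_eq: "?S = ?H \<inter> ((\<lambda>v. ?a + v) -` D)" by auto
        show "openin (top_of_set ?H) ?S" unfolding S_eq by (rule openin_open_Int[OF op])
        show "subspace ?H" by (rule subspace_transverse_kernel)
        show "dim (UNIV :: (real ^ 'n) set) \<le> dim ?H" by (simp add: dim_transverse_kernel J)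
        show "continuous_on ?S (\<lambda>v. leaf_coord c (h (?a + v)))"
          by (rule continuous_on_compose2[OF cont]) (use S_iff in \<open>auto intro!: continuous_intros\<close>)
        show "inj_on (\<lambda>v. leaf_coord c (h (?a + v))) ?S"
        proof (rule inj_onI)
          fix v v' assume v: "v \<in> ?S" "v' \<in> ?S" "leaf_coord c (h (?a + v)) = leaf_coord c (h (?a + v'))"
          then show "v = v'" using h_inj[OF y y u, of "?a + v" "?a + v'"] unfolding S_iff by simp
        qed
      qed auto
      then show ?thesis by (simp add: O'_eq)
    qed
    have ne: "O' (t y u) \<noteq> {}" if "y \<in> ball y0 r" for y
      using pull(3)[OF that u] by (auto simp: O'_def)
    have disj: "t y u = t y' u" if yy: "y \<in> ball y0 r" "y' \<in> ball y0 r" and q: "q \<in> O' (t y u)" "q \<in> O' (t y' u)" for y y' q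
    proof -
      obtain x x' where x: "x \<in> slice (t y u)" "x' \<in> slice (t y' u)" "leaf_coord c (h x) = leaf_coord c (h x')"
        using q by (auto simp: O'_def)
      then have "x = x'" using h_inj yy u by blast
      then show ?thesis using x by (simp add: slice_def)
    qed
    have "countable (O' ` ?C)"
    proof (rule countable_disjoint_open_subsets)
      show "open S" if "S \<in> O' ` ?C" for S using that O'_open by auto
      show "pairwise disjnt (O' ` ?C)"
        unfolding pairwise_def disjnt_iff
      proof (intro ballI impI allI notI)
        fix S S' q assume S: "S \<in> O' ` ?C" "S' \<in> O' ` ?C" "S \<noteq> S'" "q \<in> S \<and> q \<in> S'"
        obtain y where y: "y \<in> ball y0 r" "S = O' (t y u)" using S(1) by blast
        obtain y' where y': "y' \<in> ball y0 r" "S' = O' (t y' u)" using S(2) by blast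
        have "t y u = t y' u" using disj[OF y(1) y'(1), of q] S(4) y(2) y'(2) by simp
        then show False using S(3) y(2) y'(2) by simp
      qed
    qed
    moreover have "inj_on O' ?C"
    proof (rule inj_onI)
      fix s s' assume s: "s \<in> ?C" "s' \<in> ?C" "O' s = O' s'"
      obtain y where y: "y \<in> ball y0 r" "s = t y u" using s(1) by blast
      obtain y' where y': "y' \<in> ball y0 r" "s' = t y' u" using s(2) by blast
      obtain q where "q \<in> O' s" using ne[OF y(1)] y(2) by blast
      then show "s = s'" using disj[OF y(1) y'(1), of q] s(3) y(2) y'(2) by simp
    qed
    ultimately have "countable ?C" by (rule countable_image_inj_on)
    then show False using unc by blast
  qed
  show ?thesis
  proof (rule that[OF rW(1-5)])
    show "\<forall>y\<in>ball y0 r. \<forall>u\<in>W. f (?p y u) \<in> V \<and> transverse J (\<psi> (f (?p y u))) = transverse J (\<psi> (f (?p y0 u)))"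
      using const rW(6) by (auto simp: t_def Q_def)
    show "inj_on (\<lambda>u. transverse J (\<psi> (f (?p y0 u)))) W"
    proof (rule inj_onI)
      fix u v
      assume uv: "u \<in> W" "v \<in> W" "transverse J (\<psi> (f (?p y0 u))) = transverse J (\<psi> (f (?p y0 v)))"
      \<comment> \<open>Equal transverse coordinates put both points on one slice, and a slice lies
        over a single transverse parameter of \<open>M\<close>.\<close>
      have "\<psi> (f (?p y0 v)) \<in> slice (t y0 u)"
        using pull(3)[OF y0r uv(2)] uv(3) by (simp add: t_def)
      then have "trans_coord c (?p y0 v) = u" using pull(2)[OF y0r uv(2)] pull(4)[OF y0r uv(1)] by metis
      moreover have "trans_coord c (?p y0 v) = v" using chart_inv_mem(3)[OF y0] uv(2) rW(4) by blast
      ultimately show "u = v" by simp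
    qed
  qed
qed

end

section \<open>Lipschitz holonomy\<close>

context embedded_foliated_space
begin

text \<open>Continuity at the single point \<open>w0\<close>: sections are total functions with
  arbitrary values off the transversal, so only their behaviour near \<open>w0\<close> is
  meaningful.\<close>

definition germ_continuous :: "'x \<Rightarrow> ('x \<Rightarrow> 'a) \<Rightarrow> bool" where
  "germ_continuous w0 s \<longleftrightarrow> s w0 \<in> topspace M \<and>
     (\<forall>Q. openin M Q \<and> s w0 \<in> Q \<longrightarrow> (\<exists>W. openin X W \<and> w0 \<in> W \<and> (\<forall>u\<in>W. s u \<in> Q)))"

definition tcoord :: "('b \<Rightarrow> real ^ 'm) \<Rightarrow> 'a \<Rightarrow> real ^ 'm" where
  "tcoord \<psi> p = transverse J (\<psi> (f p))"

text \<open>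
  A map \<open>s\<close> from the transversal into \<open>M\<close> is regarded as a local section near \<open>w0\<close>.  Quantifying
  over all charts at the two base points makes the relation transitive.
\<close>

definition dominated :: "'x \<Rightarrow> ('x \<Rightarrow> 'a) \<Rightarrow> ('x \<Rightarrow> 'a) \<Rightarrow> bool" where
  "dominated w0 s s' \<longleftrightarrow> (\<forall>V \<psi> V' \<psi>'. (V, \<psi>) \<in> B \<and> (V', \<psi>') \<in> B \<and> f (s w0) \<in> V \<and> f (s' w0) \<in> V' \<longrightarrow>
     (\<exists>W L. openin X W \<and> w0 \<in> W \<and> 0 \<le> L \<and> (\<forall>u\<in>W. \<forall>v\<in>W.
        norm (tcoord \<psi>' (s' u) - tcoord \<psi>' (s' v)) \<le> L * norm (tcoord \<psi> (s u) - tcoord \<psi> (s v)))))"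

lemma dominatedD:
  assumes "dominated w0 s s'" "(V, \<psi>) \<in> B" "(V', \<psi>') \<in> B" "f (s w0) \<in> V" "f (s' w0) \<in> V'"
  obtains W L where "openin X W" "w0 \<in> W" "0 \<le> L"
    "\<forall>u\<in>W. \<forall>v\<in>W. norm (tcoord \<psi>' (s' u) - tcoord \<psi>' (s' v)) \<le> L * norm (tcoord \<psi> (s u) - tcoord \<psi> (s v))"
proof -
  from assms(1)[unfolded dominated_def, rule_format, OF conjI[OF assms(2) conjI[OF assms(3) conjI[OF assms(4,5)]]]]
  show thesis by (elim exE conjE) (rule that)
qed

lemma dominated_trans:
  assumes 1: "dominated w0 s s'" and 2: "dominated w0 s' s''" and M: "s' w0 \<in> topspace M"
  shows "dominated w0 s s''"
  unfolding dominated_def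
proof (intro allI impI, elim conjE)
  fix V \<psi> V'' \<psi>''
  assume V: "(V, \<psi>) \<in> B" "(V'', \<psi>'') \<in> B" "f (s w0) \<in> V" "f (s'' w0) \<in> V''"
  obtain V' \<psi>' where V': "(V', \<psi>') \<in> B" "f (s' w0) \<in> V'"
    using chart_exists f_mem[OF M] by blast
  obtain W1 L1 where 1: "openin X W1" "w0 \<in> W1" "0 \<le> L1"
    "\<forall>u\<in>W1. \<forall>v\<in>W1. norm (tcoord \<psi>' (s' u) - tcoord \<psi>' (s' v)) \<le> L1 * norm (tcoord \<psi> (s u) - tcoord \<psi> (s v))"
    by (rule dominatedD[OF 1 V(1) V'(1) V(3) V'(2)])
  obtain W2 L2 where 2: "openin X W2" "w0 \<in> W2" "0 \<le> L2"
    "\<forall>u\<in>W2. \<forall>v\<in>W2. norm (tcoord \<psi>'' (s'' u) - tcoord \<psi>'' (s'' v)) \<le> L2 * norm (tcoord \<psi>' (s' u) - tcoord \<psi>' (s' v))"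
    by (rule dominatedD[OF 2 V'(1) V(2) V'(2) V(4)])
  have "norm (tcoord \<psi>'' (s'' u) - tcoord \<psi>'' (s'' v)) \<le> (L2 * L1) * norm (tcoord \<psi> (s u) - tcoord \<psi> (s v))"
    if "u \<in> W1 \<inter> W2" "v \<in> W1 \<inter> W2" for u v
  proof -
    have "norm (tcoord \<psi>'' (s'' u) - tcoord \<psi>'' (s'' v)) \<le> L2 * norm (tcoord \<psi>' (s' u) - tcoord \<psi>' (s' v))"
      using 2(4) that by simp
    also have "\<dots> \<le> L2 * (L1 * norm (tcoord \<psi> (s u) - tcoord \<psi> (s v)))"
      using 1(4) 2(3) that by (intro mult_left_mono) simp_all
    finally show ?thesis by (simp add: mult.assoc)
  qed
  then show "\<exists>W L. openin X W \<and> w0 \<in> W \<and> 0 \<le> L \<and> (\<forall>u\<in>W. \<forall>v\<in>W.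
      norm (tcoord \<psi>'' (s'' u) - tcoord \<psi>'' (s'' v)) \<le> L * norm (tcoord \<psi> (s u) - tcoord \<psi> (s v)))"
    using 1(1-3) 2(1-3) by (intro exI[of _ "W1 \<inter> W2"] exI[of _ "L2 * L1"]) (simp add: openin_Int)
qed

lemma germ_transition:
  assumes s: "germ_continuous w0 s"
    and V: "(V, \<psi>) \<in> B" "(V', \<psi>') \<in> B" "f (s w0) \<in> V" "f (s w0) \<in> V'"
  obtains W L where "openin X W" "w0 \<in> W" "0 \<le> L"
    "\<forall>u\<in>W. \<forall>v\<in>W. norm (tcoord \<psi>' (s u) - tcoord \<psi>' (s v)) \<le> L * norm (tcoord \<psi> (s u) - tcoord \<psi> (s v))"
proof -
  obtain \<Omega> L where \<Omega>: "openin N \<Omega>" "f (s w0) \<in> \<Omega>"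
    "\<forall>p\<in>\<Omega>. \<forall>q\<in>\<Omega>. norm (transverse J (\<psi>' p) - transverse J (\<psi>' q)) \<le> L * norm (transverse J (\<psi> p) - transverse J (\<psi> q))"
    by (rule transition_Lipschitz[OF V]) blast
  have "openin M {p \<in> topspace M. f p \<in> \<Omega>}"
    by (rule openin_continuous_map_preimage[OF continuous_map_f \<Omega>(1)])
  moreover have "s w0 \<in> {p \<in> topspace M. f p \<in> \<Omega>}" using s \<Omega>(2) by (simp add: germ_continuous_def)
  ultimately obtain W where W: "openin X W" "w0 \<in> W" "\<forall>u\<in>W. s u \<in> {p \<in> topspace M. f p \<in> \<Omega>}"
    using s unfolding germ_continuous_def by blast
  show ?thesis
  \<comment> \<open>The constant of the transition comes without a sign; the absolute value makes it
    nonnegative, as needed to multiply constants along a chain.\<close>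
  proof (rule that[OF W(1,2), of "\<bar>L\<bar>"]; (intro ballI)?)
    fix u v assume "u \<in> W" "v \<in> W"
    then have "norm (tcoord \<psi>' (s u) - tcoord \<psi>' (s v)) \<le> L * norm (tcoord \<psi> (s u) - tcoord \<psi> (s v))"
      using W(3) \<Omega>(3) by (simp add: tcoord_def)
    also have "\<dots> \<le> \<bar>L\<bar> * norm (tcoord \<psi> (s u) - tcoord \<psi> (s v))"
      by (intro mult_right_mono) simp_all
    finally show "norm (tcoord \<psi>' (s u) - tcoord \<psi>' (s v)) \<le> \<bar>L\<bar> * norm (tcoord \<psi> (s u) - tcoord \<psi> (s v))" .
  qed simp
qed

text \<open>Two sections running through the same plaques of one box have the same coordinates
  there; changing from \<open>\<psi>\<close> to \<open>\<psi>0\<close> along \<open>s\<close> and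
  from \<open>\<psi>0\<close> to \<open>\<psi>'\<close> along \<open>s'\<close> multiplies the two
  constants.\<close>

lemma dominated_same_tcoord:
  assumes s: "germ_continuous w0 s" and s': "germ_continuous w0 s'"
    and V0: "(V0, \<psi>0) \<in> B" "f (s w0) \<in> V0" "f (s' w0) \<in> V0"
    and W0: "openin X W0" "w0 \<in> W0" "\<forall>u\<in>W0. tcoord \<psi>0 (s u) = tcoord \<psi>0 (s' u)"
  shows "dominated w0 s s'"
  unfolding dominated_def
proof (intro allI impI, elim conjE)
  fix V \<psi> V' \<psi>'
  assume V: "(V, \<psi>) \<in> B" "(V', \<psi>') \<in> B" "f (s w0) \<in> V" "f (s' w0) \<in> V'"
  obtain W1 L1 where 1: "openin X W1" "w0 \<in> W1" "0 \<le> L1"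
    "\<forall>u\<in>W1. \<forall>v\<in>W1. norm (tcoord \<psi>0 (s u) - tcoord \<psi>0 (s v)) \<le> L1 * norm (tcoord \<psi> (s u) - tcoord \<psi> (s v))"
    by (rule germ_transition[OF s V(1) V0(1) V(3) V0(2)])
  obtain W2 L2 where 2: "openin X W2" "w0 \<in> W2" "0 \<le> L2"
    "\<forall>u\<in>W2. \<forall>v\<in>W2. norm (tcoord \<psi>' (s' u) - tcoord \<psi>' (s' v)) \<le> L2 * norm (tcoord \<psi>0 (s' u) - tcoord \<psi>0 (s' v))"
    by (rule germ_transition[OF s' V0(1) V(2) V0(3) V(4)])
  have "norm (tcoord \<psi>' (s' u) - tcoord \<psi>' (s' v)) \<le> (L2 * L1) * norm (tcoord \<psi> (s u) - tcoord \<psi> (s v))"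
    if "u \<in> W0 \<inter> W1 \<inter> W2" "v \<in> W0 \<inter> W1 \<inter> W2" for u v
  proof -
    have "norm (tcoord \<psi>' (s' u) - tcoord \<psi>' (s' v)) \<le> L2 * norm (tcoord \<psi>0 (s' u) - tcoord \<psi>0 (s' v))"
      using 2(4) that by simp
    also have "\<dots> = L2 * norm (tcoord \<psi>0 (s u) - tcoord \<psi>0 (s v))"
      using W0(3) that by simp
    also have "\<dots> \<le> L2 * (L1 * norm (tcoord \<psi> (s u) - tcoord \<psi> (s v)))"
      using 1(4) 2(3) that by (intro mult_left_mono) simp_all
    finally show ?thesis by (simp add: mult.assoc)
  qed
  then show "\<exists>W L. openin X W \<and> w0 \<in> W \<and> 0 \<le> L \<and> (\<forall>u\<in>W. \<forall>v\<in>W.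
      norm (tcoord \<psi>' (s' u) - tcoord \<psi>' (s' v)) \<le> L * norm (tcoord \<psi> (s u) - tcoord \<psi> (s v)))"
    using 1(1-3) 2(1-3) W0(1,2) by (intro exI[of _ "W0 \<inter> W1 \<inter> W2"] exI[of _ "L2 * L1"]) (simp add: openin_Int)
qed

text \<open>Continuity of \<open>h\<close> is asked only at \<open>w0\<close>, since a holonomy map
  has arbitrary values away from the overlap.\<close>

lemma dominated_compose:
  assumes d: "dominated (h w0) s s'"
    and h: "\<forall>W'. openin X W' \<and> h w0 \<in> W' \<longrightarrow> (\<exists>W. openin X W \<and> w0 \<in> W \<and> (\<forall>u\<in>W. h u \<in> W'))"
  shows "dominated w0 (\<lambda>u. s (h u)) (\<lambda>u. s' (h u))"
  unfolding dominated_def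
proof (intro allI impI, elim conjE)
  fix V \<psi> V' \<psi>'
  assume V: "(V, \<psi>) \<in> B" "(V', \<psi>') \<in> B" "f (s (h w0)) \<in> V" "f (s' (h w0)) \<in> V'"
  obtain W' L where W': "openin X W'" "h w0 \<in> W'" "0 \<le> L"
    "\<forall>u\<in>W'. \<forall>v\<in>W'. norm (tcoord \<psi>' (s' u) - tcoord \<psi>' (s' v)) \<le> L * norm (tcoord \<psi> (s u) - tcoord \<psi> (s v))"
    by (rule dominatedD[OF d V])
  obtain W where "openin X W" "w0 \<in> W" "\<forall>u\<in>W. h u \<in> W'"
    using h[rule_format, OF conjI[OF W'(1,2)]] by (elim exE conjE)
  then show "\<exists>W L. openin X W \<and> w0 \<in> W \<and> 0 \<le> L \<and> (\<forall>u\<in>W. \<forall>v\<in>W.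
      norm (tcoord \<psi>' (s' (h u)) - tcoord \<psi>' (s' (h v))) \<le> L * norm (tcoord \<psi> (s (h u)) - tcoord \<psi> (s (h v))))"
    using W'(3,4) by (intro exI[of _ W] exI[of _ L] conjI ballI) simp_all
qed

lemma germ_continuous_compose:
  assumes "germ_continuous (h w0) s"
    and "\<forall>W'. openin X W' \<and> h w0 \<in> W' \<longrightarrow> (\<exists>W. openin X W \<and> w0 \<in> W \<and> (\<forall>u\<in>W. h u \<in> W'))"
  shows "germ_continuous w0 (\<lambda>u. s (h u))"
  unfolding germ_continuous_def
proof (intro conjI allI impI)
  show "s (h w0) \<in> topspace M" using assms(1) by (simp add: germ_continuous_def)
  fix Q assume "openin M Q \<and> s (h w0) \<in> Q"
  from assms(1)[unfolded germ_continuous_def, THEN conjunct2, rule_format, OF this]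
  obtain W' where W': "openin X W'" "h w0 \<in> W'" "\<forall>u\<in>W'. s u \<in> Q" by (elim exE conjE)
  obtain W where "openin X W" "w0 \<in> W" "\<forall>u\<in>W. h u \<in> W'"
    using assms(2)[rule_format, OF conjI[OF W'(1,2)]] by (elim exE conjE)
  then show "\<exists>W. openin X W \<and> w0 \<in> W \<and> (\<forall>u\<in>W. s (h u) \<in> Q)"
    using W'(3) by (intro exI[of _ W]) simp
qed

section \<open>Comparing sections along plaques and across charts\<close>

lemma germ_continuous_chart:
  assumes c: "clopen_chart M X A c" and y: "y \<in> open_cube 1" and w0: "w0 \<in> chart_trans c"
  shows "germ_continuous w0 (\<lambda>u. chart_inv M c (y, u))"
proof -
  interpret clopen_chart M X A c by (rule c)
  show ?thesis
    unfolding germ_continuous_def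
  proof (rule conjI; (intro allI impI, elim conjE)?)
    show "chart_inv M c (y, w0) \<in> topspace M"
      using chart_inv_mem(1)[OF y w0] openin_subset[OF openin_dom] by blast
  next
    fix Q assume Q: "openin M Q" "chart_inv M c (y, w0) \<in> Q"
    obtain r W where "r > 0" "openin X W" "w0 \<in> W" "W \<subseteq> T" "ball y r \<subseteq> open_cube 1"
      "\<forall>y\<in>ball y r. \<forall>u\<in>W. chart_inv M c (y, u) \<in> Q"
      by (rule chart_inv_neighbourhood[OF y w0 Q])
    then show "\<exists>W. openin X W \<and> w0 \<in> W \<and> (\<forall>u\<in>W. chart_inv M c (y, u) \<in> Q)"
      by (intro exI[of _ W]) simp
  qed
qed

text \<open>Nearby heights in a plaque share the transverse coordinate of a box, hence dominate each
  other. Connectedness of the cube links any two heights; as this argument wants a symmetric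
  relation, both directions are carried along.\<close>

lemma dominated_same_chart:
  fixes c :: "('a, 'n::finite, 'x) fol_chart"
  assumes c: "clopen_chart M X A c" and J: "card J = CARD('n)" and w0: "w0 \<in> chart_trans c"
    and y: "y \<in> open_cube 1" "y' \<in> open_cube 1"
  shows "dominated w0 (\<lambda>u. chart_inv M c (y, u)) (\<lambda>u. chart_inv M c (y', u))"
proof -
  interpret clopen_chart M X A c by (rule c)
  let ?s = "\<lambda>y u. chart_inv M c (y, u)"
  let ?R = "\<lambda>y y'. dominated w0 (?s y) (?s y') \<and> dominated w0 (?s y') (?s y)"
  have M: "?s y w0 \<in> topspace M" if "y \<in> open_cube 1" for y
    using chart_inv_mem(1)[OF that w0] openin_subset[OF openin_dom] by blast
  have "?R y y'"
  proof (rule connected_equivalence_relation[of "open_cube 1" y y' ?R])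
    show "connected (open_cube 1 :: (real ^ 'n) set)"
      by (rule convex_connected[OF convex_open_cube])
    show "?R x z" if R: "?R x y" "?R y z" and y: "y \<in> open_cube 1" for x y z
      using dominated_trans[OF conjunct1[OF R(1)] conjunct1[OF R(2)] M[OF y]]
        dominated_trans[OF conjunct2[OF R(2)] conjunct2[OF R(1)] M[OF y]] ..
    fix a :: "real ^ 'n" assume a: "a \<in> open_cube 1"
    obtain V \<psi> where V: "(V, \<psi>) \<in> B" "f (?s a w0) \<in> V"
      using chart_exists f_mem[OF M[OF a]] by blast
    obtain r W where rW: "r > 0" "openin X W" "w0 \<in> W" "W \<subseteq> T" "ball a r \<subseteq> open_cube 1"
      "\<forall>y\<in>ball a r. \<forall>u\<in>W. f (?s y u) \<in> V \<and> transverse J (\<psi> (f (?s y u))) = transverse J (\<psi> (f (?s a u)))"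
      by (rule transverse_constant[OF c J a w0 V]) (rule that)
    have dom: "dominated w0 (?s x) (?s x')" if "x \<in> ball a r" "x' \<in> ball a r" for x x'
    proof (rule dominated_same_tcoord[OF _ _ V(1) _ _ rW(2,3)])
      show "germ_continuous w0 (?s x)" "germ_continuous w0 (?s x')"
        by (rule germ_continuous_chart[OF c _ w0]; use rW(5) that in blast)+
      show "f (?s x w0) \<in> V" "f (?s x' w0) \<in> V" using rW(3,6) that by blast+
      show "\<forall>u\<in>W. tcoord \<psi> (?s x u) = tcoord \<psi> (?s x' u)" using rW(6) that by (simp add: tcoord_def)
    qed
    have "\<forall>x\<in>ball a r. ?R a x" using rW(1) by (intro ballI conjI dom) simp_all
    moreover have "openin (top_of_set (open_cube 1)) (ball a r)"
      by (rule open_openin_trans[OF open_open_cube open_ball rW(5)])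
    ultimately show "\<exists>T. openin (top_of_set (open_cube 1)) T \<and> a \<in> T \<and> (\<forall>x\<in>T. ?R a x)"
      using rW(1) by (intro exI[of _ "ball a r"]) simp
  qed (use y in auto)
  then show ?thesis by blast
qed

lemma zero_mem_open_cube: "0 \<in> (open_cube 1 :: (real ^ 'n::finite) set)"
  by (simp add: open_cube_def)

text \<open>The center of a plaque of \<open>c\<close> need not lie in \<open>c'\<close>. So the
  section slides from height 0 to the height of \<open>z\<close>, passes to \<open>c'\<close> at
  \<open>z\<close>, and slides back to height 0 there.\<close>

lemma dominated_holonomy:
  fixes c c' :: "('a, 'n::finite, 'x) fol_chart"
  assumes c: "clopen_chart M X A c" and c': "clopen_chart M X A c'" and J: "card J = CARD('n)"
    and z: "z \<in> chart_dom c \<inter> chart_dom c'" "trans_coord c z = w0"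
    and h: "\<forall>p\<in>chart_dom c \<inter> chart_dom c'. trans_coord c' p = h (trans_coord c p)"
  shows "\<forall>W'. openin X W' \<and> h w0 \<in> W' \<longrightarrow> (\<exists>W. openin X W \<and> w0 \<in> W \<and> (\<forall>u\<in>W. h u \<in> W'))"
    and "dominated w0 (\<lambda>u. chart_inv M c (0, u)) (\<lambda>u. chart_inv M c' (0, h u))"
proof -
  interpret c: clopen_chart M X A c by (rule c)
  interpret c': clopen_chart M X A c' by (rule c')
  define y where "y = leaf_coord c z"
  define y' where "y' = leaf_coord c' z"
  let ?s = "\<lambda>u. chart_inv M c (y, u)"
  have y: "y \<in> open_cube 1" and w0: "w0 \<in> chart_trans c"
    using c.coords_mem[of z] z by (auto simp: y_def)
  have y': "y' \<in> open_cube 1" and hw0: "h w0 \<in> chart_trans c'" and tz: "trans_coord c' z = h w0"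
    using c'.coords_mem[of z] z h by (auto simp: y'_def)
  have sw0: "?s w0 = z" using c.chart_inv_coords[of z] z by (simp add: y_def)
  have s'w0: "chart_inv M c' (y', h w0) = z" using c'.chart_inv_coords[of z] z tz by (simp add: y'_def)
  have zM: "z \<in> topspace M" using z openin_subset[OF c.openin_dom] by blast
  \<comment> \<open>For parameters near \<open>w0\<close> the section through \<open>z\<close> stays
    in the overlap, where the second chart reads its transverse parameter as \<open>h u\<close> and
    its height as close to \<open>y'\<close>.\<close>
  have nbhd: "\<exists>W. openin X W \<and> w0 \<in> W \<and> (\<forall>u\<in>W. ?s u \<in> chart_dom c' \<and> leaf_coord c' (?s u) \<in> R \<and>
      trans_coord c' (?s u) = h u \<and> h u \<in> W')"
    if R: "open R" "y' \<in> R" and W': "openin X W'" "h w0 \<in> W'" for R W'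
  proof -
    let ?top = "topspace (subtopology M (chart_dom c'))"
    have top: "?top = chart_dom c'" using openin_subset[OF c'.openin_dom] by auto
    have "openin (subtopology M (chart_dom c')) {p \<in> ?top. leaf_coord c' p \<in> R}"
      using R by (intro openin_continuous_map_preimage[OF c'.continuous_map_leaf_coord]) simp
    then have 1: "openin M {p \<in> chart_dom c'. leaf_coord c' p \<in> R}"
      unfolding top by (rule openin_trans_full[OF _ c'.openin_dom])
    have "openin (subtopology M (chart_dom c')) {p \<in> ?top. trans_coord c' p \<in> W'}"
      using W'(1) by (rule openin_continuous_map_preimage[OF c'.continuous_map_trans_coord])
    then have 2: "openin M {p \<in> chart_dom c'. trans_coord c' p \<in> W'}"
      unfolding top by (rule openin_trans_full[OF _ c'.openin_dom])
    let ?Q = "chart_dom c \<inter> ({p \<in> chart_dom c'. leaf_coord c' p \<in> R} \<inter> {p \<in> chart_dom c'. trans_coord c' p \<in> W'})"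
    have Q: "openin M ?Q" by (intro openin_Int 1 2 c.openin_dom)
    have zQ: "chart_inv M c (y, w0) \<in> ?Q" using z R W' tz sw0 by (simp add: y'_def)
    obtain r W where W: "r > 0" "openin X W" "w0 \<in> W" "W \<subseteq> chart_trans c" "ball y r \<subseteq> open_cube 1"
      "\<forall>y\<in>ball y r. \<forall>u\<in>W. chart_inv M c (y, u) \<in> ?Q"
      by (rule c.chart_inv_neighbourhood[OF y w0 Q zQ])
    have "?s u \<in> chart_dom c' \<and> leaf_coord c' (?s u) \<in> R \<and> trans_coord c' (?s u) = h u \<and> h u \<in> W'"
      if "u \<in> W" for u
    proof -
      have "?s u \<in> ?Q" using W(1,6) that by simp
      moreover have "trans_coord c (?s u) = u" using c.chart_inv_mem(3)[OF y] W(4) that by blast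
      ultimately show ?thesis using h by fastforce
    qed
    then show ?thesis using W(2,3) by (intro exI[of _ W] conjI ballI) simp_all
  qed
  show h_cont: "\<forall>W'. openin X W' \<and> h w0 \<in> W' \<longrightarrow> (\<exists>W. openin X W \<and> w0 \<in> W \<and> (\<forall>u\<in>W. h u \<in> W'))"
  proof (intro allI impI, elim conjE)
    fix W' assume "openin X W'" "h w0 \<in> W'"
    from nbhd[OF open_UNIV UNIV_I this]
    obtain W where "openin X W" "w0 \<in> W" "\<forall>u\<in>W. ?s u \<in> chart_dom c' \<and> leaf_coord c' (?s u) \<in> UNIV \<and>
      trans_coord c' (?s u) = h u \<and> h u \<in> W'" by (elim exE conjE)
    then show "\<exists>W. openin X W \<and> w0 \<in> W \<and> (\<forall>u\<in>W. h u \<in> W')" by (intro exI[of _ W]) simp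
  qed
  obtain V \<psi> where V: "(V, \<psi>) \<in> B" "f z \<in> V"
    using chart_exists f_mem[OF zM] by blast
  have V': "f (chart_inv M c' (y', h w0)) \<in> V" using V s'w0 by simp
  obtain r W' where rW: "r > 0" "openin X W'" "h w0 \<in> W'" "W' \<subseteq> chart_trans c'" "ball y' r \<subseteq> open_cube 1"
      "\<forall>y\<in>ball y' r. \<forall>u\<in>W'. f (chart_inv M c' (y, u)) \<in> V \<and>
         transverse J (\<psi> (f (chart_inv M c' (y, u)))) = transverse J (\<psi> (f (chart_inv M c' (y', u))))"
      by (rule transverse_constant[OF c' J y' hw0 V(1) V']) (rule that)
  have "y' \<in> ball y' r" using rW(1) by simp
  from nbhd[OF open_ball this rW(2,3)] obtain W where W: "openin X W" "w0 \<in> W"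
    "\<forall>u\<in>W. ?s u \<in> chart_dom c' \<and> leaf_coord c' (?s u) \<in> ball y' r \<and> trans_coord c' (?s u) = h u \<and> h u \<in> W'"
    by (elim exE conjE)
  \<comment> \<open>Both points lie on the plaque of \<open>c'\<close> over \<open>h u\<close>, at
    heights within the ball around \<open>y'\<close> where the box coordinate is constant along
    plaques.\<close>
  have mid: "dominated w0 ?s (\<lambda>u. chart_inv M c' (y', h u))"
  proof (rule dominated_same_tcoord[OF _ _ V(1) _ _ W(1,2)])
    show "germ_continuous w0 ?s" by (rule germ_continuous_chart[OF c y w0])
    show "germ_continuous w0 (\<lambda>u. chart_inv M c' (y', h u))"
      by (rule germ_continuous_compose[where h = h, OF germ_continuous_chart[OF c' y' hw0] h_cont])
    show "f (?s w0) \<in> V" "f (chart_inv M c' (y', h w0)) \<in> V" using sw0 V V' by simp_all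
    show "\<forall>u\<in>W. tcoord \<psi> (?s u) = tcoord \<psi> (chart_inv M c' (y', h u))"
    proof
      fix u assume "u \<in> W"
      then have u: "?s u \<in> chart_dom c'" "leaf_coord c' (?s u) \<in> ball y' r" "trans_coord c' (?s u) = h u" "h u \<in> W'"
        using W(3) by blast+
      have "tcoord \<psi> (chart_inv M c' (leaf_coord c' (?s u), h u)) = tcoord \<psi> (chart_inv M c' (y', h u))"
        using bspec[OF bspec[OF rW(6) u(2)] u(4)] by (simp add: tcoord_def)
      then show "tcoord \<psi> (?s u) = tcoord \<psi> (chart_inv M c' (y', h u))"
        using c'.chart_inv_coords[OF u(1)] u(3) by simp
    qed
  qed
  have "dominated w0 (\<lambda>u. chart_inv M c (0, u)) ?s"
    by (rule dominated_same_chart[OF c J w0 zero_mem_open_cube y])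
  from dominated_trans[OF this mid]
  have "dominated w0 (\<lambda>u. chart_inv M c (0, u)) (\<lambda>u. chart_inv M c' (y', h u))"
    using sw0 zM by simp
  moreover have "dominated w0 (\<lambda>u. chart_inv M c' (y', h u)) (\<lambda>u. chart_inv M c' (0, h u))"
    by (rule dominated_compose[where h = h, OF dominated_same_chart[OF c' J hw0 y' zero_mem_open_cube] h_cont])
  ultimately show "dominated w0 (\<lambda>u. chart_inv M c (0, u)) (\<lambda>u. chart_inv M c' (0, h u))"
    by (rule dominated_trans) (use s'w0 zM in simp)
qed

end

section \<open>The transversal space\<close>

lemma topspace_transversal_space:
  assumes "\<forall>i<\<nu>. openin X (chart_trans (\<phi> i))"
  shows "topspace (transversal_space X \<nu> \<phi>) = Sigma {..<\<nu>} (\<lambda>i. chart_trans (\<phi> i))"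
proof -
  have "topspace X \<inter> chart_trans (\<phi> i) = chart_trans (\<phi> i)" if "i < \<nu>" for i
    using openin_subset[OF assms[rule_format, OF that]] by blast
  then show ?thesis by (auto simp: transversal_space_def)
qed

lemma openin_transversal_space:
  assumes "\<forall>i<\<nu>. openin X (chart_trans (\<phi> i))"
  shows "openin (transversal_space X \<nu> \<phi>) U \<longleftrightarrow>
    U \<subseteq> Sigma {..<\<nu>} (\<lambda>i. chart_trans (\<phi> i)) \<and> (\<forall>i<\<nu>. openin X {x. (i, x) \<in> U})"
proof -
  have "openin (subtopology X (chart_trans (\<phi> i))) {x. (i, x) \<in> U} \<longleftrightarrow> openin X {x. (i, x) \<in> U}"
    if "i < \<nu>" "U \<subseteq> Sigma {..<\<nu>} (\<lambda>i. chart_trans (\<phi> i))" for i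
    using that(2) by (subst openin_open_subtopology[OF assms[rule_format, OF that(1)]]) auto
  moreover have "openin (transversal_space X \<nu> \<phi>) U \<longleftrightarrow> U \<subseteq> Sigma {..<\<nu>} (\<lambda>i. chart_trans (\<phi> i)) \<and>
      (\<forall>i<\<nu>. openin (subtopology X (chart_trans (\<phi> i))) {x. (i, x) \<in> U})"
    using topspace_transversal_space[of \<nu> X \<phi>, OF assms]
    by (auto simp add: transversal_space_def openin_sum_topology)
  ultimately show ?thesis by blast
qed

lemma continuous_map_Pair_transversal_space:
  "i < \<nu> \<Longrightarrow> continuous_map (subtopology X (chart_trans (\<phi> i))) (transversal_space X \<nu> \<phi>) (Pair i)"
  unfolding transversal_space_def
  using continuous_map_component_injection[of i "{..<\<nu>}" "\<lambda>i. subtopology X (chart_trans (\<phi> i))"] by simp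

lemma continuous_map_transversal_space:
  assumes op: "\<forall>i<\<nu>. openin X (chart_trans (\<phi> i))"
    and g: "\<And>i. i < \<nu> \<Longrightarrow> continuous_map (subtopology X (chart_trans (\<phi> i))) R (\<lambda>x. g (i, x))"
  shows "continuous_map (transversal_space X \<nu> \<phi>) R g"
proof -
  have top: "topspace (subtopology X (chart_trans (\<phi> i))) = chart_trans (\<phi> i)" if "i < \<nu>" for i
    using openin_subset[OF op[rule_format, OF that]] by auto
  have Y: "topspace (transversal_space X \<nu> \<phi>) = Sigma {..<\<nu>} (\<lambda>i. chart_trans (\<phi> i))"
    by (rule topspace_transversal_space[of \<nu> X \<phi>, OF op])
  show ?thesis
    unfolding continuous_map_def
  proof (intro conjI allI impI)
    show "g \<in> topspace (transversal_space X \<nu> \<phi>) \<rightarrow> topspace R"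
    proof (rule Pi_I)
      fix p assume "p \<in> topspace (transversal_space X \<nu> \<phi>)"
      then have "fst p < \<nu>" "snd p \<in> chart_trans (\<phi> (fst p))" unfolding Y by auto
      then have p: "fst p < \<nu>" "snd p \<in> topspace (subtopology X (chart_trans (\<phi> (fst p))))"
        using top by blast+
      show "g p \<in> topspace R" using funcset_mem[OF continuous_map_funspace[OF g[OF p(1)]] p(2)] by simp
    qed
    fix U assume U: "openin R U"
    have "openin X {x. (i, x) \<in> {p \<in> topspace (transversal_space X \<nu> \<phi>). g p \<in> U}}" if i: "i < \<nu>" for i
    proof -
      have "openin (subtopology X (chart_trans (\<phi> i))) {x \<in> topspace (subtopology X (chart_trans (\<phi> i))). g (i, x) \<in> U}"
        by (rule openin_continuous_map_preimage[OF g[OF i] U])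
      then have "openin X {x \<in> topspace (subtopology X (chart_trans (\<phi> i))). g (i, x) \<in> U}"
        by (rule openin_trans_full[OF _ op[rule_format, OF i]])
      moreover have "{x. (i, x) \<in> {p \<in> topspace (transversal_space X \<nu> \<phi>). g p \<in> U}} =
          {x \<in> topspace (subtopology X (chart_trans (\<phi> i))). g (i, x) \<in> U}"
        unfolding Y top[OF i] using i by auto
      ultimately show ?thesis by simp
    qed
    then show "openin (transversal_space X \<nu> \<phi>) {p \<in> topspace (transversal_space X \<nu> \<phi>). g p \<in> U}"
      unfolding openin_transversal_space[of \<nu> X \<phi>, OF op] Y by auto
  qed
qed

lemma compact_space_transversal_space:
  assumes op: "\<forall>i<\<nu>. openin X (chart_trans (\<phi> i))"
    and comp: "\<forall>i<\<nu>. compactin X (chart_trans (\<phi> i))"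
  shows "compact_space (transversal_space X \<nu> \<phi>)"
proof -
  let ?Y = "transversal_space X \<nu> \<phi>"
  have "compactin ?Y (Pair i ` chart_trans (\<phi> i))" if "i < \<nu>" for i
    using comp[rule_format, OF that]
    by (intro image_compactin[OF _ continuous_map_Pair_transversal_space[OF that]]) (simp add: compactin_subtopology)
  then have "compactin ?Y (\<Union>i\<in>{..<\<nu>}. Pair i ` chart_trans (\<phi> i))"
    by (intro compactin_Union) auto
  moreover have "(\<Union>i\<in>{..<\<nu>}. Pair i ` chart_trans (\<phi> i)) = topspace ?Y"
    unfolding topspace_transversal_space[of \<nu> X \<phi>, OF op] by auto
  ultimately show ?thesis by (simp add: compact_space_def)
qed

text \<open>A connected set is constant under the projection to the discrete index set and under the
  projection to \<open>X\<close>.\<close>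

lemma totally_disconnected_transversal_space:
  assumes op: "\<forall>i<\<nu>. openin X (chart_trans (\<phi> i))"
    and X: "totally_disconnected_space X"
  shows "totally_disconnected_space (transversal_space X \<nu> \<phi>)"
  unfolding totally_disconnected_space_def
proof (intro allI impI)
  let ?Y = "transversal_space X \<nu> \<phi>"
  fix S assume S: "connectedin ?Y S"
  have "continuous_map ?Y (discrete_topology (UNIV :: nat set)) fst"
    by (rule continuous_map_transversal_space[of \<nu> X \<phi>, OF op]) simp_all
  from connectedin_continuous_map_image[OF this S]
  have "connectedin (discrete_topology (UNIV :: nat set)) (fst ` S)" .
  then obtain i where i: "fst ` S \<subseteq> {i}" by (auto simp: connectedin_discrete_topology)
  have "continuous_map ?Y X snd"
    by (rule continuous_map_transversal_space[of \<nu> X \<phi>, OF op]) (simp_all add: continuous_map_from_subtopology)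
  from connectedin_continuous_map_image[OF this S]
  obtain x where x: "snd ` S \<subseteq> {x}" using X unfolding totally_disconnected_space_def by blast
  have "S \<subseteq> {(i, x)}" using i x by (auto simp: image_subset_iff prod_eq_iff)
  then show "\<exists>p. S \<subseteq> {p}" by blast
qed

text \<open>\<open>\<Theta>\<close> takes values in \<open>real \<times> real ^ 'm\<close>: the
  index of the piece, and the transverse coordinate of the plaque center in the box chosen for that
  piece.\<close>

lemma (in embedded_foliated_space) finite_geometric_entropy:
  fixes \<phi> :: "nat \<Rightarrow> ('a, 'n::finite, 'x) fol_chart"
  assumes J: "card J = CARD('n)"
    and \<phi>: "\<And>i. i < \<nu> \<Longrightarrow> clopen_chart M X A (\<phi> i)"
    and closed: "\<And>i j. i < \<nu> \<Longrightarrow> j < \<nu> \<Longrightarrow> closedin (subtopology X (chart_trans (\<phi> i))) (overlap_trans \<phi> i j)"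
    and hol: "\<And>i j w. i < \<nu> \<Longrightarrow> j < \<nu> \<Longrightarrow> w \<in> overlap_trans \<phi> i j \<Longrightarrow> \<exists>!w'. plaques_meet \<phi> i j w w'"
    and d: "metric_for (transversal_space X \<nu> \<phi>) d"
  shows "geometric_entropy (transversal_space X \<nu> \<phi>) (holonomy_generators \<nu> \<phi>) d \<noteq> \<infinity>"
proof -
  define Y where "Y = transversal_space X \<nu> \<phi>"
  define S where "S = holonomy_generators \<nu> \<phi>"
  define sec where "sec q = chart_inv M (\<phi> (fst q)) (0, snd q)" for q :: "nat \<times> 'x"
  have op: "\<forall>i<\<nu>. openin X (chart_trans (\<phi> i))"
    using clopen_chart.open_trans[OF \<phi>] by blast
  have comp: "\<forall>i<\<nu>. compactin X (chart_trans (\<phi> i))"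
    using clopen_chart.compact_trans[OF \<phi>] by blast
  have topY: "topspace Y = Sigma {..<\<nu>} (\<lambda>i. chart_trans (\<phi> i))"
    unfolding Y_def by (rule topspace_transversal_space[of \<nu> X \<phi>, OF op])
  have compY: "compact_space Y" unfolding Y_def by (rule compact_space_transversal_space[of \<nu> X \<phi>, OF op comp])
  have tdY: "totally_disconnected_space Y"
    unfolding Y_def by (rule totally_disconnected_transversal_space[of \<nu> X \<phi>, OF op tot_disc])
  have hausY: "Hausdorff_space Y"
    using d Metric_space.Hausdorff_space_mtopology unfolding metric_for_def Y_def by metis
  have sec_dom: "sec q \<in> chart_dom (\<phi> (fst q))" if "q \<in> topspace Y" for q
    using clopen_chart.chart_inv_mem(1)[OF \<phi> zero_mem_open_cube, of "fst q" "snd q"] that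
    by (auto simp: sec_def topY)
  have sec_M: "sec q \<in> topspace M" if "q \<in> topspace Y" for q
  proof -
    have "fst q < \<nu>" using that by (auto simp: topY)
    from subsetD[OF openin_subset[OF clopen_chart.openin_dom[OF \<phi>[OF this]]] sec_dom[OF that]] show ?thesis .
  qed
  have cont_sec: "continuous_map Y M sec"
    unfolding Y_def
  proof (rule continuous_map_transversal_space[of \<nu> X \<phi>, OF op])
    fix i assume i: "i < \<nu>"
    have "continuous_map (subtopology X (chart_trans (\<phi> i)))
        (subtopology (prod_topology euclidean X) (open_cube 1 \<times> chart_trans (\<phi> i))) (\<lambda>x. (0, x))"
      using zero_mem_open_cube
      by (auto simp: continuous_map_in_subtopology continuous_map_paired continuous_map_from_subtopology)
    from continuous_map_compose[OF this clopen_chart.continuous_map_chart_inv[OF \<phi>[OF i]]]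
    show "continuous_map (subtopology X (chart_trans (\<phi> i))) M (\<lambda>x. sec (i, x))"
      by (simp add: sec_def comp_def)
  qed

  \<comment> \<open>Each piece must lie in one component, have all its plaque centers in one box,
    and be embedded by that box's transverse coordinate.\<close>
  have "\<exists>V \<psi> P. (V, \<psi>) \<in> B \<and> openin Y P \<and> q \<in> P \<and> fst ` P \<subseteq> {fst q} \<and>
      f ` sec ` P \<subseteq> V \<and> inj_on (\<lambda>q. tcoord \<psi> (sec q)) P" if q: "q \<in> topspace Y" for q
  proof -
    obtain i w where iw: "q = (i, w)" "i < \<nu>" "w \<in> chart_trans (\<phi> i)" using q by (auto simp: topY)
    obtain V \<psi> where V: "(V, \<psi>) \<in> B" "f (sec q) \<in> V"
      using chart_exists f_mem[OF sec_M[OF q]] by blast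
    have V2: "f (chart_inv M (\<phi> i) (0, w)) \<in> V" using V(2) by (simp add: sec_def iw)
    obtain r W where W: "r > 0" "openin X W" "w \<in> W" "W \<subseteq> chart_trans (\<phi> i)"
      "\<forall>y\<in>ball 0 r. \<forall>u\<in>W. f (chart_inv M (\<phi> i) (y, u)) \<in> V \<and>
        transverse J (\<psi> (f (chart_inv M (\<phi> i) (y, u)))) = transverse J (\<psi> (f (chart_inv M (\<phi> i) (0, u))))"
      "inj_on (\<lambda>u. transverse J (\<psi> (f (chart_inv M (\<phi> i) (0, u))))) W"
      by (rule transverse_constant[OF \<phi>[OF iw(2)] J zero_mem_open_cube iw(3) V(1) V2]) (rule that)
    have "{x. (j, x) \<in> Pair i ` W} = (if j = i then W else {})" for j by auto
    then have "openin Y (Pair i ` W)"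
      unfolding Y_def openin_transversal_space[of \<nu> X \<phi>, OF op] using W(2,4) iw(2) by auto
    moreover have "f ` sec ` Pair i ` W \<subseteq> V" using W(1,5) by (auto simp: sec_def)
    moreover have "inj_on (\<lambda>q. tcoord \<psi> (sec q)) (Pair i ` W)"
      using W(6) by (auto simp: inj_on_def sec_def tcoord_def)
    ultimately show ?thesis
      using V(1) W(3) iw(1)
      by (intro exI[of _ V] exI[of _ \<psi>] exI[of _ "Pair i ` W"]) auto
  qed
  then obtain V \<psi> P where ch: "\<And>q. q \<in> topspace Y \<Longrightarrow> (V q, \<psi> q) \<in> B \<and> openin Y (P q) \<and> q \<in> P q \<and>
      fst ` P q \<subseteq> {fst q} \<and> f ` sec ` P q \<subseteq> V q \<and> inj_on (\<lambda>p. tcoord (\<psi> q) (sec p)) (P q)"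
    by metis
  have "openin Y (P q) \<and> q \<in> P q" if "q \<in> topspace Y" for q using ch[OF that] by simp
  then obtain idx :: "nat \<times> 'x \<Rightarrow> nat" and pt where idx_cont: "continuous_map Y (discrete_topology UNIV) idx"
    and idx': "\<forall>q\<in>topspace Y. pt (idx q) \<in> topspace Y \<and> q \<in> P (pt (idx q))"
    by (rule clopen_partition[OF compY hausY tdY])
  note idx = bspec[OF idx']
  \<comment> \<open>The box depends on the index alone, so \<open>\<Theta>\<close> is given by one
    chart on each clopen piece and the pieces paste continuously.\<close>
  define vert where "vert k = \<psi> (pt k)" for k :: nat
  define \<Theta> where "\<Theta> q = (real (idx q), tcoord (vert (idx q)) (sec q))" for q
  have idx_open: "openin Y {q \<in> topspace Y. idx q = k}" for k
    using openin_continuous_map_preimage[OF idx_cont, of "{k}"] by simp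
  have in_chart: "(V (pt (idx q)), vert (idx q)) \<in> B" "f (sec q) \<in> V (pt (idx q))" if "q \<in> topspace Y" for q
    using ch[of "pt (idx q)"] idx[OF that] by (auto simp: vert_def)

  have cont\<Theta>: "continuous_map Y euclidean \<Theta>"
  proof (rule pasting_lemma[where I = UNIV and T = "\<lambda>k. {q \<in> topspace Y. idx q = k}"
        and f = "\<lambda>k q. (real k, tcoord (vert k) (sec q))"])
    fix k
    show "openin Y {q \<in> topspace Y. idx q = k}" by (rule idx_open)
    let ?D = "{q \<in> topspace Y. idx q = k}"
    show "continuous_map (subtopology Y ?D) euclidean (\<lambda>q. (real k, tcoord (vert k) (sec q)))"
    proof (cases "?D = {}")
      case True
      show ?thesis unfolding True by (simp add: continuous_map_def)
    next
      case False
      then obtain q where "q \<in> topspace Y" "idx q = k" by blast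
      then have B: "(V (pt k), vert k) \<in> B" using in_chart(1) by blast
      have "continuous_map (subtopology Y ?D) (subtopology N (V (pt k))) (\<lambda>q. f (sec q))"
        using continuous_map_from_subtopology[OF continuous_map_compose[OF cont_sec continuous_map_f]] in_chart(2)
        by (auto simp: continuous_map_in_subtopology comp_def)
      from continuous_map_compose[OF continuous_map_compose[OF this continuous_chart[OF B]]
          continuous_map_iff_continuous2[THEN iffD2, OF continuous_on_transverse]]
      have "continuous_map (subtopology Y ?D) euclidean (\<lambda>q. tcoord (vert k) (sec q))"
        by (simp add: comp_def tcoord_def)
      then have "continuous_map (subtopology Y ?D) (prod_topology euclidean euclidean) (\<lambda>q. (real k, tcoord (vert k) (sec q)))"
        unfolding continuous_map_paired by simp
      then show ?thesis by simp
    qed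
  qed (auto simp: \<Theta>_def)

  have inj\<Theta>: "inj_on \<Theta> (topspace Y)"
  proof (rule inj_onI)
    fix p q assume pq: "p \<in> topspace Y" "q \<in> topspace Y" "\<Theta> p = \<Theta> q"
    then have eq: "idx p = idx q" "tcoord (vert (idx q)) (sec p) = tcoord (vert (idx q)) (sec q)"
      by (auto simp: \<Theta>_def)
    then have mem: "p \<in> P (pt (idx q))" "q \<in> P (pt (idx q))" "pt (idx q) \<in> topspace Y"
      using idx[OF pq(1)] idx[OF pq(2)] by simp_all
    have "inj_on (\<lambda>p. tcoord (vert (idx q)) (sec p)) (P (pt (idx q)))"
      using ch[OF mem(3)] unfolding vert_def by (elim conjE)
    from inj_onD[OF this eq(2) mem(1,2)] show "p = q" .
  qed

  have sep\<Theta>: "1 \<le> norm (\<Theta> p - \<Theta> q)" if pq: "p \<in> topspace Y" "q \<in> topspace Y" "fst p \<noteq> fst q" for p q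
  proof -
    \<comment> \<open>A piece is contained in some \<open>P\<close> and hence in one component, so
      its index determines the component.\<close>
    have "idx p \<noteq> idx q"
    proof
      assume eq: "idx p = idx q"
      have "fst r = fst (pt (idx r))" if "r \<in> topspace Y" for r
      proof -
        have "r \<in> P (pt (idx r))" "fst ` P (pt (idx r)) \<subseteq> {fst (pt (idx r))}"
          using idx[OF that] ch[OF idx[OF that, THEN conjunct1]] by simp_all
        then show ?thesis by blast
      qed
      from this[OF pq(1)] this[OF pq(2)] have "fst p = fst (pt (idx p))" "fst q = fst (pt (idx q))" .
      then show False using eq pq(3) by simp
    qed
    then have "1 \<le> norm (fst (\<Theta> p - \<Theta> q))" by (simp add: \<Theta>_def)
    also have "\<dots> \<le> norm (\<Theta> p - \<Theta> q)" using norm_fst_le[of "fst (\<Theta> p - \<Theta> q)" "snd (\<Theta> p - \<Theta> q)"] by (simp only: prod.collapse)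
    finally show ?thesis .
  qed

  have ranS: "ran s \<subseteq> topspace Y" and
    lipS: "\<exists>L\<ge>1. \<forall>u\<in>dom s. \<forall>v\<in>dom s. norm (\<Theta> (the (s u)) - \<Theta> (the (s v))) \<le> L * norm (\<Theta> u - \<Theta> v)"
    if s: "s \<in> S" for s
  proof -
    obtain i j where ij: "i < \<nu>" "j < \<nu>" and s: "s = holonomy_generator \<phi> i j"
      using s by (auto simp: S_def holonomy_generators_def)
    define h where "h = transition_holonomy \<phi> i j"
    define K where "K = Pair i ` overlap_trans \<phi> i j"
    have s_eq: "s q = (if q \<in> K then Some (j, h (snd q)) else None)" for q
      by (cases q) (auto simp: s holonomy_generator_def K_def h_def)
    then have dom: "dom s = K" by (auto simp: dom_def split: if_splits)
    have the_s: "the (s (i, u)) = (j, h u)" if "(i, u) \<in> K" for u using that by (simp add: s_eq)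
    have h_eq: "\<forall>p\<in>chart_dom (\<phi> i) \<inter> chart_dom (\<phi> j). trans_coord (\<phi> j) p = h (trans_coord (\<phi> i) p)"
    proof
      fix p assume p: "p \<in> chart_dom (\<phi> i) \<inter> chart_dom (\<phi> j)"
      then have "\<exists>!w'. plaques_meet \<phi> i j (trans_coord (\<phi> i) p) w'"
        by (intro hol ij) (auto simp: overlap_trans_def)
      moreover have "plaques_meet \<phi> i j (trans_coord (\<phi> i) p) (trans_coord (\<phi> j) p)"
        using p by (auto simp: plaques_meet_def)
      ultimately show "trans_coord (\<phi> j) p = h (trans_coord (\<phi> i) p)"
        unfolding h_def transition_holonomy_def by (metis the1_equality)
    qed
    have hT: "h u \<in> chart_trans (\<phi> j)" "u \<in> chart_trans (\<phi> i)" if u: "u \<in> overlap_trans \<phi> i j" for u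
    proof -
      obtain p where p: "p \<in> chart_dom (\<phi> i) \<inter> chart_dom (\<phi> j)" "u = trans_coord (\<phi> i) p"
        using u by (auto simp: overlap_trans_def)
      then show "h u \<in> chart_trans (\<phi> j)" "u \<in> chart_trans (\<phi> i)"
        using h_eq clopen_chart.coords_mem(2)[OF \<phi>[OF ij(1)], of p] clopen_chart.coords_mem(2)[OF \<phi>[OF ij(2)], of p]
        by auto
    qed
    have hY: "(j, h u) \<in> topspace Y" "(i, u) \<in> topspace Y" if "u \<in> overlap_trans \<phi> i j" for u
      using hT[OF that] ij by (simp_all add: topY)
    show "ran s \<subseteq> topspace Y"
      using hY by (auto simp: ran_def s_eq K_def split: if_splits)
    have KY: "K \<subseteq> topspace Y" using hY by (auto simp: K_def)
    \<comment> \<open>Closedness of the overlap is what makes the domain of a generator compact, so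
      that local Lipschitz constants become a global one.\<close>
    have "compactin (subtopology X (chart_trans (\<phi> i))) (overlap_trans \<phi> i j)"
      using comp[rule_format, OF ij(1)] closed[OF ij] by (intro closedin_compact_space) (simp_all add: compact_space_subtopology)
    then have compK: "compactin Y K"
      unfolding K_def Y_def by (rule image_compactin[OF _ continuous_map_Pair_transversal_space[OF ij(1)]])
    have "compact (\<Theta> ` topspace Y)"
      using image_compactin[OF compY[unfolded compact_space_def] cont\<Theta>] by simp
    then have "bounded (\<Theta> ` topspace Y)" by (rule compact_imp_bounded)
    moreover have "(\<lambda>q. \<Theta> (the (s q))) ` K \<subseteq> \<Theta> ` topspace Y"
      using hY by (auto simp: K_def s_eq)
    ultimately have bnd: "bounded ((\<lambda>q. \<Theta> (the (s q))) ` K)" by (rule bounded_subset)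
    have loc: "\<exists>W L. openin Y W \<and> w \<in> W \<and> (\<forall>u\<in>W \<inter> K. \<forall>v\<in>W \<inter> K.
        norm (\<Theta> (the (s u)) - \<Theta> (the (s v))) \<le> L * norm (\<Theta> u - \<Theta> v))" if w: "w \<in> K" for w
    proof -
      obtain w0 where w0: "w = (i, w0)" "w0 \<in> overlap_trans \<phi> i j" using w by (auto simp: K_def)
      obtain z where z: "z \<in> chart_dom (\<phi> i) \<inter> chart_dom (\<phi> j)" "trans_coord (\<phi> i) z = w0"
        using w0(2) by (auto simp: overlap_trans_def)
      note hd = dominated_holonomy[OF \<phi>[OF ij(1)] \<phi>[OF ij(2)] J z h_eq]
      define k where "k = idx (i, w0)"
      define k' where "k' = idx (j, h w0)"
      have c1: "(V (pt k), vert k) \<in> B" "f (chart_inv M (\<phi> i) (0, w0)) \<in> V (pt k)"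
        using in_chart[OF hY(2)[OF w0(2)]] by (simp_all add: k_def sec_def)
      have c2: "(V (pt k'), vert k') \<in> B" "f (chart_inv M (\<phi> j) (0, h w0)) \<in> V (pt k')"
        using in_chart[OF hY(1)[OF w0(2)]] by (simp_all add: k'_def sec_def)
      obtain W1 L where W1: "openin X W1" "w0 \<in> W1" "0 \<le> L"
        "\<forall>u\<in>W1. \<forall>v\<in>W1. norm (tcoord (vert k') (chart_inv M (\<phi> j) (0, h u)) - tcoord (vert k') (chart_inv M (\<phi> j) (0, h v)))
           \<le> L * norm (tcoord (vert k) (chart_inv M (\<phi> i) (0, u)) - tcoord (vert k) (chart_inv M (\<phi> i) (0, v)))"
        by (rule dominatedD[OF hd(2) c1(1) c2(1) c1(2) c2(2)])
      have "openin Y {q \<in> topspace Y. idx q = k'}" by (rule idx_open)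
      then have "openin X {x. (j, x) \<in> {q \<in> topspace Y. idx q = k'}}"
        unfolding Y_def openin_transversal_space[of \<nu> X \<phi>, OF op] using ij(2) by blast
      moreover have "h w0 \<in> {x. (j, x) \<in> {q \<in> topspace Y. idx q = k'}}"
        using hY(1)[OF w0(2)] by (simp add: k'_def)
      ultimately obtain W2 where W2: "openin X W2" "w0 \<in> W2"
        "\<forall>u\<in>W2. h u \<in> {x. (j, x) \<in> {q \<in> topspace Y. idx q = k'}}"
        using hd(1) by meson
      \<comment> \<open>\<open>W2\<close> fixes the index \<open>k'\<close> of the image, and
        intersecting with the piece of index \<open>k\<close> fixes that of the source. The first
        components of \<open>\<Theta>\<close> then cancel and only the transverse coordinates are
        compared.\<close>
      let ?W3 = "W1 \<inter> W2 \<inter> chart_trans (\<phi> i)"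
      have "{x. (l, x) \<in> Pair i ` ?W3} = (if l = i then ?W3 else {})" for l by auto
      then have "openin Y (Pair i ` ?W3)"
        unfolding Y_def openin_transversal_space[of \<nu> X \<phi>, OF op] using W1(1) W2(1) op[rule_format, OF ij(1)] ij(1)
        by (auto intro!: openin_Int)
      then have Wo: "openin Y (Pair i ` ?W3 \<inter> {q \<in> topspace Y. idx q = k})"
        using idx_open by (rule openin_Int)
      have wW: "w \<in> Pair i ` ?W3 \<inter> {q \<in> topspace Y. idx q = k}"
        using w0 W1(2) W2(2) hT(2)[OF w0(2)] hY(2)[OF w0(2)] by (simp add: k_def)
      have "norm (\<Theta> (the (s u)) - \<Theta> (the (s v))) \<le> L * norm (\<Theta> u - \<Theta> v)"
        if uv: "u \<in> (Pair i ` ?W3 \<inter> {q \<in> topspace Y. idx q = k}) \<inter> K"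
          "v \<in> (Pair i ` ?W3 \<inter> {q \<in> topspace Y. idx q = k}) \<inter> K" for u v
      proof -
        obtain u' where u': "u = (i, u')" "u' \<in> W1" "u' \<in> W2" using uv(1) by blast
        obtain v' where v': "v = (i, v')" "v' \<in> W1" "v' \<in> W2" using uv(2) by blast
        have "\<Theta> (the (s u)) = (real k', tcoord (vert k') (chart_inv M (\<phi> j) (0, h u')))"
          "\<Theta> (the (s v)) = (real k', tcoord (vert k') (chart_inv M (\<phi> j) (0, h v')))"
          using W2(3) u' v' uv by (simp_all add: s_eq \<Theta>_def sec_def)
        moreover have "\<Theta> u = (real k, tcoord (vert k) (chart_inv M (\<phi> i) (0, u')))"
          "\<Theta> v = (real k, tcoord (vert k) (chart_inv M (\<phi> i) (0, v')))"
          using u' v' uv by (simp_all add: \<Theta>_def sec_def)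
        ultimately show ?thesis using W1(4) u'(2) v'(2) by (simp add: norm_Pair)
      qed
      then show ?thesis using Wo wW by blast
    qed
    show "\<exists>L\<ge>1. \<forall>u\<in>dom s. \<forall>v\<in>dom s. norm (\<Theta> (the (s u)) - \<Theta> (the (s v))) \<le> L * norm (\<Theta> u - \<Theta> v)"
      unfolding dom
      by (rule locally_Lipschitz_imp_Lipschitz[OF compK cont\<Theta> inj_on_subset[OF inj\<Theta> KY] bnd loc])
  qed
  from lipS obtain Lf where Lf: "\<And>s. s \<in> S \<Longrightarrow> Lf s \<ge> 1 \<and> (\<forall>u\<in>dom s. \<forall>v\<in>dom s.
      norm (\<Theta> (the (s u)) - \<Theta> (the (s v))) \<le> Lf s * norm (\<Theta> u - \<Theta> v))"
    by metis
  have "S \<subseteq> (\<lambda>(i, j). holonomy_generator \<phi> i j) ` ({..<\<nu>} \<times> {..<\<nu>})"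
    by (auto simp: S_def holonomy_generators_def)
  then have finS: "finite S" by (rule finite_subset) simp
  \<comment> \<open>There are finitely many generators, so one constant serves all; including 1 in
    the maximum makes \<open>L \<ge> 1\<close> even without generators.\<close>
  define L where "L = Max (insert 1 (Lf ` S))"
  have "geometric_entropy Y S d \<noteq> \<infinity>"
  proof (rule Lipschitz_imp_finite_entropy[OF compY _ cont\<Theta> inj\<Theta> ranS])
    show "metric_for Y d" using d by (simp add: Y_def)
    show "1 \<le> L" unfolding L_def using finS by (intro Max_ge) auto
    fix s u v assume suv: "s \<in> S" "u \<in> dom s" "v \<in> dom s"
    have "norm (\<Theta> (the (s u)) - \<Theta> (the (s v))) \<le> Lf s * norm (\<Theta> u - \<Theta> v)"
      using Lf[OF suv(1)] suv(2,3) by blast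
    also have "\<dots> \<le> L * norm (\<Theta> u - \<Theta> v)"
      unfolding L_def using finS suv(1) by (intro mult_right_mono Max_ge) auto
    finally show "norm (\<Theta> (the (s u)) - \<Theta> (the (s v))) \<le> L * norm (\<Theta> u - \<Theta> v)" .
  qed (use sep\<Theta> in auto)
  then show ?thesis by (simp add: Y_def S_def)
qed

theorem corollary4p6:
  fixes M :: "'a topology" and X :: "'x topology"
    and A :: "('a, 'n::finite, 'x) fol_chart set"
    and G :: "('a, 'n, 'x) leaf_metric"
    and dM :: "'a \<Rightarrow> 'a \<Rightarrow> real" and e :: real
    and \<nu> :: nat and \<phi> :: "nat \<Rightarrow> ('a, 'n, 'x) fol_chart"
    and d :: "nat \<times> 'x \<Rightarrow> nat \<times> 'x \<Rightarrow> real"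
  assumes "matchbox_manifold M X A"
    and "leafwise_riemannian_metric M X A G"
    and "metric_for M dM" and "e > 0"
    and "regular_covering M X A G dM e \<nu> \<phi>"
    and "metric_for (transversal_space X \<nu> \<phi>) d"
    and "geometric_entropy (transversal_space X \<nu> \<phi>) (holonomy_generators \<nu> \<phi>) d = \<infinity>"
  shows "\<not> (\<exists>(N :: 'b topology) (J :: 'm::finite set) (B :: ('b, 'm) mfd_chart set) Z f.
           C1_foliation N J B \<and> card J = CARD('n) \<and> invariant_set J B Z \<and>
           homeomorphic_map M (subtopology N Z) f \<and>
           (\<forall>L\<in>leaves M A. f ` L \<in> mfd_leaves J B))"
proof (intro notI, elim exE conjE)
  fix N :: "'b topology" and J :: "'m set" and B :: "('b, 'm) mfd_chart set" and Z f
  assume N: "C1_foliation N J B" "card J = CARD('n)" "invariant_set J B Z"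
    "homeomorphic_map M (subtopology N Z) f"
  note cov = assms(5)[unfolded regular_covering_def]
  interpret embedded_foliated_space N J B M X Z f
    using N assms(1) by unfold_locales (simp_all add: matchbox_manifold_def)
  have "geometric_entropy (transversal_space X \<nu> \<phi>) (holonomy_generators \<nu> \<phi>) d \<noteq> \<infinity>"
  proof (rule finite_geometric_entropy[OF N(2) _ _ _ assms(6)])
    show "clopen_chart M X A (\<phi> i)" if "i < \<nu>" for i
      using cov[THEN conjunct1, rule_format, OF that] by (simp add: clopen_chart_def)
    show "closedin (subtopology X (chart_trans (\<phi> i))) (overlap_trans \<phi> i j)" if "i < \<nu>" "j < \<nu>" for i j
      using cov[THEN conjunct2, THEN conjunct2, THEN conjunct2, THEN conjunct2, THEN conjunct1,
          rule_format, OF that] by simp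
    show "\<exists>!w'. plaques_meet \<phi> i j w w'" if ij: "i < \<nu>" "j < \<nu>" and w: "w \<in> overlap_trans \<phi> i j" for i j w
    proof -
      \<comment> \<open>The covering grants a unique target plaque only for charts that meet; a
        point of the overlap transversal witnesses that they do.\<close>
      have "chart_dom (\<phi> i) \<inter> chart_dom (\<phi> j) \<noteq> {}" using w by (auto simp: overlap_trans_def)
      from cov[THEN conjunct2, THEN conjunct2, THEN conjunct2, THEN conjunct2, THEN conjunct2,
          rule_format, OF ij this] w show ?thesis by (elim conjE bspec)
    qed
  qed
  then show False using assms(7) by simp
qed

end
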